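(* Let $R\to S$ be a pure extension of Noetherian rings, let $I$ be an ideal of $R$, and let $M$ be an $R$-module. For some $i\ge 0$, if $\operatorname{Supp}_S(H^i_I(M)\otimes_R S)$ is a Zariski closed subset of $\operatorname{Spec}S$, then $\operatorname{Supp}_R H^i_I(M)$ is a Zariski closed subset of $\operatorname{Spec}R$.
   Context: All rings are commutative Noetherian with unity; modules are arbitrary. An injective ring homomorphism $R\to S$ is a pure extension if for every $R$-module $N$ the map $N\to N\otimes_R S$, $x\mapsto x\otimes 1$, is injective. $H^i_I(M)$ is the $i$-th local cohomology module of $M$ with support in $I$. *)

theory Defs
  imports
    "HOL-Algebra.Algebra"
    "HOL-Analysis.Abstract_Topology"
begin

section \<open>The prime spectrum\<close>

definition Spec :: "('a, 'r) ring_scheme \<Rightarrow> 'a set set" where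
  "Spec R = {P. primeideal P R}"

definition zariski_topology :: "('a, 'r) ring_scheme \<Rightarrow> 'a set topology" where
  "zariski_topology R = topology (\<lambda>U. \<exists>J. ideal J R \<and> U = {P \<in> Spec R. \<not> J \<subseteq> P})"

lemma (in cring) istopology_zariski:
  "istopology (\<lambda>U. \<exists>J. ideal J R \<and> U = {P \<in> Spec R. \<not> J \<subseteq> P})"
  unfolding istopology_def
proof (intro conjI allI impI)
  fix U V
  assume "\<exists>J. ideal J R \<and> U = {P \<in> Spec R. \<not> J \<subseteq> P}"
  then obtain J where J: "ideal J R" "U = {P \<in> Spec R. \<not> J \<subseteq> P}" by blast
  assume "\<exists>J. ideal J R \<and> V = {P \<in> Spec R. \<not> J \<subseteq> P}"
  then obtain K where K: "ideal K R" "V = {P \<in> Spec R. \<not> K \<subseteq> P}" by blast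
  have "\<not> J \<inter> K \<subseteq> P" if P: "primeideal P R" and JK: "\<not> J \<subseteq> P" "\<not> K \<subseteq> P" for P
  proof -
    obtain a where a: "a \<in> J" "a \<notin> P" using JK(1) by blast
    obtain b where b: "b \<in> K" "b \<notin> P" using JK(2) by blast
    have c: "a \<in> carrier R" "b \<in> carrier R"
      using ideal.Icarr[OF J(1) a(1)] ideal.Icarr[OF K(1) b(1)] .
    have "a \<otimes> b \<in> J \<inter> K"
      using ideal.I_r_closed[OF J(1) a(1) c(2)] ideal.I_l_closed[OF K(1) b(1) c(1)] by (rule IntI)
    moreover have "a \<otimes> b \<notin> P"
      using primeideal.I_prime[OF P c] a(2) b(2) by argo
    ultimately show ?thesis by blast
  qed
  then have "\<not> J \<subseteq> P \<and> \<not> K \<subseteq> P \<longleftrightarrow> \<not> J \<inter> K \<subseteq> P" if "primeideal P R" for P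
    using that by blast
  then have "U \<inter> V = {P \<in> Spec R. \<not> J \<inter> K \<subseteq> P}"
    unfolding J(2) K(2) Spec_def by blast
  then show "\<exists>L. ideal L R \<and> U \<inter> V = {P \<in> Spec R. \<not> L \<subseteq> P}"
    using i_intersect[OF J(1) K(1)] by blast
next
  fix \<K>
  assume "\<forall>U\<in>\<K>. \<exists>J. ideal J R \<and> U = {P \<in> Spec R. \<not> J \<subseteq> P}"
  then obtain J where J: "\<And>U. U \<in> \<K> \<Longrightarrow> ideal (J U) R"
    "\<And>U. U \<in> \<K> \<Longrightarrow> U = {P \<in> Spec R. \<not> J U \<subseteq> P}" by metis
  have sub: "(\<Union>U\<in>\<K>. J U) \<subseteq> carrier R"
  proof (rule UN_least)
    show "J U \<subseteq> carrier R" if "U \<in> \<K>" for U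
      using ideal.Icarr[OF J(1)[OF that]] by (rule subsetI)
  qed
  have "Idl (\<Union>U\<in>\<K>. J U) \<subseteq> P \<longleftrightarrow> (\<forall>U\<in>\<K>. J U \<subseteq> P)" if "P \<in> Spec R" for P
  proof -
    from that have "ideal P R" by (simp add: Spec_def primeideal_def)
    from Idl_subset_ideal[OF this sub] show ?thesis by (simp add: UN_subset_iff)
  qed
  then have "(\<Union>U\<in>\<K>. {P \<in> Spec R. \<not> J U \<subseteq> P}) = {P \<in> Spec R. \<not> Idl (\<Union>U\<in>\<K>. J U) \<subseteq> P}"
    by blast
  moreover have "(\<Union>U\<in>\<K>. {P \<in> Spec R. \<not> J U \<subseteq> P}) = (\<Union>U\<in>\<K>. U)"
    by (rule SUP_cong[OF refl]) (rule J(2)[symmetric])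
  ultimately have "\<Union>\<K> = {P \<in> Spec R. \<not> Idl (\<Union>U\<in>\<K>. J U) \<subseteq> P}"
    by simp
  then show "\<exists>L. ideal L R \<and> \<Union>\<K> = {P \<in> Spec R. \<not> L \<subseteq> P}"
    using genideal_ideal[OF sub] by blast
qed

lemma (in cring) openin_zariski:
  "openin (zariski_topology R) U \<longleftrightarrow> (\<exists>J. ideal J R \<and> U = {P \<in> Spec R. \<not> J \<subseteq> P})"
  unfolding zariski_topology_def by (simp add: topology_inverse'[OF istopology_zariski])

lemma (in cring) topspace_zariski: "topspace (zariski_topology R) = Spec R"
proof
  show "topspace (zariski_topology R) \<subseteq> Spec R"
    unfolding topspace_def openin_zariski by blast
  have "\<not> carrier R \<subseteq> P" if "primeideal P R" for P
    using primeideal.I_notcarr[OF that] ideal.Icarr[OF primeideal.axioms(1)[OF that]] by blast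
  then have "{P \<in> Spec R. \<not> carrier R \<subseteq> P} = Spec R"
    by (auto simp: Spec_def)
  then have "openin (zariski_topology R) (Spec R)"
    unfolding openin_zariski using oneideal by metis
  then show "Spec R \<subseteq> topspace (zariski_topology R)"
    by (rule openin_subset)
qed

lemma (in cring) closedin_zariski:
  "closedin (zariski_topology R) A \<longleftrightarrow> (\<exists>J. ideal J R \<and> A = {P \<in> Spec R. J \<subseteq> P})"
proof -
  have "A \<subseteq> Spec R \<and> Spec R - A = {P \<in> Spec R. \<not> J \<subseteq> P} \<longleftrightarrow> A = {P \<in> Spec R. J \<subseteq> P}" for J
    by auto
  moreover have "(A \<subseteq> Spec R \<and> (\<exists>J. ideal J R \<and> Q J)) \<longleftrightarrow>
      (\<exists>J. ideal J R \<and> (A \<subseteq> Spec R \<and> Q J))" for Q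
    by iprover
  ultimately show ?thesis
    unfolding closedin_def openin_zariski topspace_zariski by (simp only:)
qed


section \<open>Modules\<close>

text \<open>
  A module record carries the fields \<open>mult\<close> and \<open>one\<close> of a ring, which are
  irrelevant for modules; new modules leave them \<open>undefined\<close>.
\<close>

definition mod_hom :: "('a, 'r) ring_scheme \<Rightarrow> ('a, 'm) module \<Rightarrow> ('a, 'n) module \<Rightarrow> ('m \<Rightarrow> 'n) set" where
  "mod_hom R M N =
    {h \<in> carrier M \<rightarrow> carrier N.
       (\<forall>x \<in> carrier M. \<forall>y \<in> carrier M. h (x \<oplus>\<^bsub>M\<^esub> y) = h x \<oplus>\<^bsub>N\<^esub> h y) \<and>
       (\<forall>a \<in> carrier R. \<forall>x \<in> carrier M. h (a \<odot>\<^bsub>M\<^esub> x) = a \<odot>\<^bsub>N\<^esub> h x)}"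

definition quotient_module :: "('a, 'm) module \<Rightarrow> 'm set \<Rightarrow> ('a, 'm set) module" where
  "quotient_module M K =
    \<lparr>carrier = a_rcosets\<^bsub>M\<^esub> K, monoid.mult = undefined, one = undefined,
     ring.zero = K, add = set_add M,
     smult = (\<lambda>a A. \<Union>x \<in> A. K +>\<^bsub>M\<^esub> (a \<odot>\<^bsub>M\<^esub> x))\<rparr>"


section \<open>Localization and support\<close>

definition fraction_rel :: "('a, 'r) ring_scheme \<Rightarrow> ('a, 'm) module \<Rightarrow> 'a set \<Rightarrow> (('m \<times> 'a) \<times> ('m \<times> 'a)) set" where
  "fraction_rel R M P =
    {((x, s), (y, t)). x \<in> carrier M \<and> y \<in> carrier M \<and> s \<in> carrier R - P \<and> t \<in> carrier R - P \<and>
       (\<exists>u \<in> carrier R - P. u \<odot>\<^bsub>M\<^esub> (t \<odot>\<^bsub>M\<^esub> x) = u \<odot>\<^bsub>M\<^esub> (s \<odot>\<^bsub>M\<^esub> y))}"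

definition fraction :: "('a, 'r) ring_scheme \<Rightarrow> ('a, 'm) module \<Rightarrow> 'a set \<Rightarrow> 'm \<Rightarrow> 'a \<Rightarrow> ('m \<times> 'a) set" where
  "fraction R M P x s = fraction_rel R M P `` {(x, s)}"

definition localization :: "('a, 'r) ring_scheme \<Rightarrow> ('a, 'm) module \<Rightarrow> 'a set \<Rightarrow> ('a, ('m \<times> 'a) set) module" where
  "localization R M P =
    \<lparr>carrier = (carrier M \<times> (carrier R - P)) // fraction_rel R M P,
     monoid.mult = undefined, one = undefined,
     ring.zero = fraction R M P \<zero>\<^bsub>M\<^esub> \<one>\<^bsub>R\<^esub>,
     add = (\<lambda>A B. \<Union>(x, s) \<in> A. \<Union>(y, t) \<in> B.
              fraction R M P ((t \<odot>\<^bsub>M\<^esub> x) \<oplus>\<^bsub>M\<^esub> (s \<odot>\<^bsub>M\<^esub> y)) (s \<otimes>\<^bsub>R\<^esub> t)),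
     smult = (\<lambda>a A. \<Union>(x, s) \<in> A. fraction R M P (a \<odot>\<^bsub>M\<^esub> x) s)\<rparr>"

definition Supp :: "('a, 'r) ring_scheme \<Rightarrow> ('a, 'm) module \<Rightarrow> 'a set set" where
  "Supp R M = {P \<in> Spec R. carrier (localization R M P) \<noteq> {\<zero>\<^bsub>localization R M P\<^esub>}}"


section \<open>Tensor products and pure extensions\<close>

definition tensor_relators ::
    "('a, 'r) ring_scheme \<Rightarrow> ('a, 'm) module \<Rightarrow> ('a, 'n) module \<Rightarrow> (('m \<times> 'n) \<Rightarrow>\<^sub>0 int) set" where
  "tensor_relators R M N =
     {frag_of (x \<oplus>\<^bsub>M\<^esub> x', y) - frag_of (x, y) - frag_of (x', y) | x x' y.
        x \<in> carrier M \<and> x' \<in> carrier M \<and> y \<in> carrier N} \<union>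
     {frag_of (x, y \<oplus>\<^bsub>N\<^esub> y') - frag_of (x, y) - frag_of (x, y') | x y y'.
        x \<in> carrier M \<and> y \<in> carrier N \<and> y' \<in> carrier N} \<union>
     {frag_of (a \<odot>\<^bsub>M\<^esub> x, y) - frag_of (x, a \<odot>\<^bsub>N\<^esub> y) | a x y.
        a \<in> carrier R \<and> x \<in> carrier M \<and> y \<in> carrier N}"

definition tensor_kernel ::
    "('a, 'r) ring_scheme \<Rightarrow> ('a, 'm) module \<Rightarrow> ('a, 'n) module \<Rightarrow> (('m \<times> 'n) \<Rightarrow>\<^sub>0 int) set" where
  "tensor_kernel R M N =
     generate (free_Abelian_group (carrier M \<times> carrier N)) (tensor_relators R M N)"

definition tensor_group ::
    "('a, 'r) ring_scheme \<Rightarrow> ('a, 'm) module \<Rightarrow> ('a, 'n) module \<Rightarrow> (('m \<times> 'n) \<Rightarrow>\<^sub>0 int) set monoid" where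
  "tensor_group R M N = free_Abelian_group (carrier M \<times> carrier N) Mod tensor_kernel R M N"

definition tensor_class ::
    "('a, 'r) ring_scheme \<Rightarrow> ('a, 'm) module \<Rightarrow> ('a, 'n) module \<Rightarrow> (('m \<times> 'n) \<Rightarrow>\<^sub>0 int) \<Rightarrow> (('m \<times> 'n) \<Rightarrow>\<^sub>0 int) set" where
  "tensor_class R M N c = tensor_kernel R M N #>\<^bsub>free_Abelian_group (carrier M \<times> carrier N)\<^esub> c"

definition restrict_scalars :: "('b, 's) ring_scheme \<Rightarrow> ('a \<Rightarrow> 'b) \<Rightarrow> ('a, 'b) module" where
  "restrict_scalars S f =
    \<lparr>carrier = carrier S, monoid.mult = monoid.mult S, one = \<one>\<^bsub>S\<^esub>,
     ring.zero = \<zero>\<^bsub>S\<^esub>, add = add S,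
     smult = (\<lambda>a s. f a \<otimes>\<^bsub>S\<^esub> s)\<rparr>"

text \<open>\<open>N \<otimes>\<^sub>R S\<close> as an \<open>S\<close>-module, with \<open>s \<cdot> (x \<otimes> t) = x \<otimes> s t\<close>.\<close>

definition base_change ::
    "('a, 'r) ring_scheme \<Rightarrow> ('b, 's) ring_scheme \<Rightarrow> ('a \<Rightarrow> 'b) \<Rightarrow> ('a, 'n) module \<Rightarrow> ('b, (('n \<times> 'b) \<Rightarrow>\<^sub>0 int) set) module" where
  "base_change R S f N =
    \<lparr>carrier = carrier (tensor_group R N (restrict_scalars S f)),
     monoid.mult = undefined, one = undefined,
     ring.zero = \<one>\<^bsub>tensor_group R N (restrict_scalars S f)\<^esub>,
     add = monoid.mult (tensor_group R N (restrict_scalars S f)),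
     smult = (\<lambda>s A. \<Union>c \<in> A. tensor_class R N (restrict_scalars S f)
                (frag_extend (\<lambda>(x, t). frag_of (x, s \<otimes>\<^bsub>S\<^esub> t)) c))\<rparr>"

definition base_change_unit ::
    "('a, 'r) ring_scheme \<Rightarrow> ('b, 's) ring_scheme \<Rightarrow> ('a \<Rightarrow> 'b) \<Rightarrow> ('a, 'n) module \<Rightarrow> 'n \<Rightarrow> (('n \<times> 'b) \<Rightarrow>\<^sub>0 int) set" where
  "base_change_unit R S f N x = tensor_class R N (restrict_scalars S f) (frag_of (x, \<one>\<^bsub>S\<^esub>))"

text \<open>
  HOL cannot quantify over all types inside a formula, so ``every \<open>R\<close>-module'' has to range
  over the modules carried by subsets of some fixed type.  The type \<open>(nat \<Rightarrow> 'a) set\<close> contains a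
  copy of every finitely generated \<open>R\<close>-module (the cosets of a submodule of some \<open>R\<^sup>k\<close>); no
  generality is lost, see \<open>pure_extension_every_module\<close> below.
\<close>

definition pure_extension :: "('a, 'r) ring_scheme \<Rightarrow> ('b, 's) ring_scheme \<Rightarrow> ('a \<Rightarrow> 'b) \<Rightarrow> bool" where
  "pure_extension R S f \<longleftrightarrow>
     f \<in> ring_hom R S \<and> inj_on f (carrier R) \<and>
     (\<forall>N :: ('a, (nat \<Rightarrow> 'a) set) module. module R N \<longrightarrow>
        inj_on (base_change_unit R S f N) (carrier N))"

lemma module_restrict_scalars:
  assumes "cring R" "cring S" "f \<in> ring_hom R S"
  shows "module R (restrict_scalars S f)"
proof -
  interpret R: cring R by fact
  interpret S: cring S by fact
  note h = ring_hom_closed[OF assms(3)] ring_hom_mult[OF assms(3)] ring_hom_add[OF assms(3)]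
    ring_hom_one[OF assms(3)]
  show ?thesis
  proof (rule moduleI)
    show "abelian_group (restrict_scalars S f)"
    proof (rule abelian_groupI)
      fix x assume "x \<in> carrier (restrict_scalars S f)"
      then show "\<exists>y\<in>carrier (restrict_scalars S f).
          y \<oplus>\<^bsub>restrict_scalars S f\<^esub> x = \<zero>\<^bsub>restrict_scalars S f\<^esub>"
        by (intro bexI[of _ "\<ominus>\<^bsub>S\<^esub> x"]) (simp_all add: restrict_scalars_def S.l_neg)
    qed (simp_all add: restrict_scalars_def S.a_ac)
  qed (simp_all add: restrict_scalars_def h S.l_distr S.r_distr S.m_assoc R.cring_axioms)
qed

lemma tensor_relators_cases:
  assumes "r \<in> tensor_relators R M N"
  obtains
      (add_left) x x' y where "r = frag_of (x \<oplus>\<^bsub>M\<^esub> x', y) - frag_of (x, y) - frag_of (x', y)"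
        "x \<in> carrier M" "x' \<in> carrier M" "y \<in> carrier N"
    | (add_right) x y y' where "r = frag_of (x, y \<oplus>\<^bsub>N\<^esub> y') - frag_of (x, y) - frag_of (x, y')"
        "x \<in> carrier M" "y \<in> carrier N" "y' \<in> carrier N"
    | (smult) a x y where "r = frag_of (a \<odot>\<^bsub>M\<^esub> x, y) - frag_of (x, a \<odot>\<^bsub>N\<^esub> y)"
        "a \<in> carrier R" "x \<in> carrier M" "y \<in> carrier N"
  using assms unfolding tensor_relators_def by blast

lemma tensor_relators_memI:
  "x \<in> carrier M \<Longrightarrow> x' \<in> carrier M \<Longrightarrow> y \<in> carrier N \<Longrightarrow>
    frag_of (x \<oplus>\<^bsub>M\<^esub> x', y) - frag_of (x, y) - frag_of (x', y) \<in> tensor_relators R M N"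
  "x \<in> carrier M \<Longrightarrow> y \<in> carrier N \<Longrightarrow> y' \<in> carrier N \<Longrightarrow>
    frag_of (x, y \<oplus>\<^bsub>N\<^esub> y') - frag_of (x, y) - frag_of (x, y') \<in> tensor_relators R M N"
  "a \<in> carrier R \<Longrightarrow> x \<in> carrier M \<Longrightarrow> y \<in> carrier N \<Longrightarrow>
    frag_of (a \<odot>\<^bsub>M\<^esub> x, y) - frag_of (x, a \<odot>\<^bsub>N\<^esub> y) \<in> tensor_relators R M N"
  unfolding tensor_relators_def by blast+

lemma tensor_relators_subset:
  assumes "module R N" "module R T"
  shows "tensor_relators R N T \<subseteq> carrier (free_Abelian_group (carrier N \<times> carrier T))"
proof -
  interpret N: module R N by fact
  interpret T: module R T by fact
  have d: "Poly_Mapping.keys (a - b) \<subseteq> A"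
    if "Poly_Mapping.keys a \<subseteq> A" "Poly_Mapping.keys b \<subseteq> A" for a b :: "_ \<Rightarrow>\<^sub>0 int" and A
    using keys_diff[of a b] that by (rule order_trans[OF _ Un_least])
  have "Poly_Mapping.keys r \<subseteq> carrier N \<times> carrier T" if "r \<in> tensor_relators R N T" for r
    using that by (cases rule: tensor_relators_cases) (hypsubst, (intro d; simp add: keys_frag_of))+
  then show ?thesis by (auto simp: free_Abelian_group_def)
qed

lemma subgroup_tensor_kernel:
  assumes "module R N" "module R T"
  shows "subgroup (tensor_kernel R N T) (free_Abelian_group (carrier N \<times> carrier T))"
  unfolding tensor_kernel_def
  by (intro group.generate_is_subgroup group_free_Abelian_group tensor_relators_subset assms)

lemma tensor_class_eq_iff:
  assumes "module R N" "module R T"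
    and c: "Poly_Mapping.keys c \<subseteq> carrier N \<times> carrier T"
    and c': "Poly_Mapping.keys c' \<subseteq> carrier N \<times> carrier T"
  shows "tensor_class R N T c = tensor_class R N T c' \<longleftrightarrow> c - c' \<in> tensor_kernel R N T"
proof
  let ?G = "free_Abelian_group (carrier N \<times> carrier T)" and ?K = "tensor_kernel R N T"
  interpret G: group ?G by (rule group_free_Abelian_group)
  have K: "subgroup ?K ?G" by (rule subgroup_tensor_kernel) fact+
  {
    assume "tensor_class R N T c = tensor_class R N T c'"
    then have "c \<in> ?K #>\<^bsub>?G\<^esub> c'"
      using G.rcos_self[OF _ K, of c] c by (simp add: tensor_class_def)
    then show "c - c' \<in> ?K" by (auto simp: r_coset_def)
  next
    assume "c - c' \<in> ?K"
    moreover have "c = (c - c') \<otimes>\<^bsub>?G\<^esub> c'" by simp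
    ultimately have "c \<in> ?K #>\<^bsub>?G\<^esub> c'" unfolding r_coset_def by blast
    then show "tensor_class R N T c = tensor_class R N T c'"
      using G.repr_independence[OF _ _ K, of c c'] c' by (simp add: tensor_class_def)
  }
qed

lemma tensor_kernel_induct [consumes 3, case_names zero rel uminus add]:
  assumes "module R N" "module R T" and c: "c \<in> tensor_kernel R N T"
    and zero: "P 0" and rel: "\<And>r. r \<in> tensor_relators R N T \<Longrightarrow> P r"
    and uminus: "\<And>r. r \<in> tensor_relators R N T \<Longrightarrow> P (- r)"
    and add: "\<And>a b. P a \<Longrightarrow> P b \<Longrightarrow> P (a + b)"
  shows "P c"
  using c unfolding tensor_kernel_def
proof (induction rule: generate.induct)
  case (inv h)
  then have "Poly_Mapping.keys h \<subseteq> carrier N \<times> carrier T"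
    using tensor_relators_subset[OF assms(1,2)] by (auto simp: free_Abelian_group_def)
  with inv uminus show ?case by simp
qed (use zero rel add in auto)

lemma tensor_kernel_closed:
  assumes "module R N" "module R T"
  shows "0 \<in> tensor_kernel R N T" "r \<in> tensor_relators R N T \<Longrightarrow> r \<in> tensor_kernel R N T"
    "a \<in> tensor_kernel R N T \<Longrightarrow> - a \<in> tensor_kernel R N T"
    "a \<in> tensor_kernel R N T \<Longrightarrow> b \<in> tensor_kernel R N T \<Longrightarrow> a + b \<in> tensor_kernel R N T"
proof -
  let ?G = "free_Abelian_group (carrier N \<times> carrier T)" and ?K = "tensor_kernel R N T"
  interpret K: subgroup ?K ?G by (rule subgroup_tensor_kernel) fact+
  show "0 \<in> ?K" using K.one_closed by simp
  show "r \<in> ?K" if "r \<in> tensor_relators R N T"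
    using that unfolding tensor_kernel_def by (rule generate.incl)
  show "- a \<in> ?K" if "a \<in> ?K"
    using K.m_inv_closed[OF that] K.mem_carrier[OF that] by simp
  show "a + b \<in> ?K" if "a \<in> ?K" "b \<in> ?K"
    using K.m_closed[OF that] by simp
qed

lemma tensor_kernel_map:
  assumes A: "module R A" and B: "module R B" and T: "module R T"
    and g: "g \<in> mod_hom R A B" and c: "c \<in> tensor_kernel R A T"
  shows "frag_extend (\<lambda>(x, t). frag_of (g x, t)) c \<in> tensor_kernel R B T"
proof -
  let ?F = "frag_extend (\<lambda>(x, t). frag_of (g x, t))"
  have gc: "g x \<in> carrier B" if "x \<in> carrier A" for x
    using g that by (auto simp: mod_hom_def)
  have ga: "g (x \<oplus>\<^bsub>A\<^esub> y) = g x \<oplus>\<^bsub>B\<^esub> g y" if "x \<in> carrier A" "y \<in> carrier A" for x y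
    using g that by (simp add: mod_hom_def)
  have gs: "g (a \<odot>\<^bsub>A\<^esub> x) = a \<odot>\<^bsub>B\<^esub> g x" if "a \<in> carrier R" "x \<in> carrier A" for a x
    using g that by (simp add: mod_hom_def)
  have rel: "?F r \<in> tensor_kernel R B T" if "r \<in> tensor_relators R A T" for r
  proof -
    from that have "?F r \<in> tensor_relators R B T"
    proof (cases rule: tensor_relators_cases)
      case (add_left x x' y)
      then show ?thesis
        using tensor_relators_memI(1)[of "g x" B "g x'" y T R] by (simp add: frag_extend_diff ga gc)
    next
      case (add_right x y y')
      then show ?thesis
        using tensor_relators_memI(2)[of "g x" B y T y' R] by (simp add: frag_extend_diff gc)
    next
      case (smult a x y)
      then show ?thesis
        using tensor_relators_memI(3)[of a R "g x" B y T] by (simp add: frag_extend_diff gs gc)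
    qed
    then show ?thesis by (rule tensor_kernel_closed(2)[OF B T])
  qed
  show ?thesis
    using A T c
  proof (induction c rule: tensor_kernel_induct)
    case (uminus r)
    then show ?case by (simp add: frag_extend_minus tensor_kernel_closed(3)[OF B T] rel)
  qed (simp_all add: frag_extend_add tensor_kernel_closed(1,4)[OF B T] rel)
qed

lemma tensor_kernel_finite_support:
  assumes N: "module R N" and T: "module R T" and c: "c \<in> tensor_kernel R N T"
  shows "\<exists>W. finite W \<and> W \<subseteq> carrier N \<and>
    (\<forall>H. submodule H R N \<and> W \<subseteq> H \<longrightarrow> c \<in> tensor_kernel R (N\<lparr>carrier := H\<rparr>) T)"
proof -
  let ?K = "\<lambda>H. tensor_kernel R (N\<lparr>carrier := H\<rparr>) T"
  let ?P = "\<lambda>c W. finite W \<and> W \<subseteq> carrier N \<and> (\<forall>H. submodule H R N \<and> W \<subseteq> H \<longrightarrow> c \<in> ?K H)"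
  note mod = submodule.submodule_is_module[OF _ N]
  have rels: "\<exists>W. finite W \<and> W \<subseteq> carrier N \<and>
      (\<forall>H. W \<subseteq> H \<longrightarrow> r \<in> tensor_relators R (N\<lparr>carrier := H\<rparr>) T)"
    if r: "r \<in> tensor_relators R N T" for r
  proof -
    from r show ?thesis
    proof (cases rule: tensor_relators_cases)
      case (add_left x x' y)
      then show ?thesis
        by (intro exI[of _ "{x, x'}"]) (simp add: tensor_relators_def, blast)
    next
      case (add_right x y y')
      then show ?thesis
        by (intro exI[of _ "{x}"]) (simp add: tensor_relators_def, blast)
    next
      case (smult a x y)
      then show ?thesis
        by (intro exI[of _ "{x}"]) (simp add: tensor_relators_def, blast)
    qed
  qed
  show "\<exists>W. ?P c W"
    using N T c
  proof (induction c rule: tensor_kernel_induct)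
    case zero
    show ?case using tensor_kernel_closed(1)[OF mod T] by blast
  next
    case (rel r)
    then show ?case using rels[OF rel] tensor_kernel_closed(2)[OF mod T] by meson
  next
    case (uminus r)
    then show ?case using rels[OF uminus] tensor_kernel_closed(2,3)[OF mod T] by meson
  next
    case (add a b)
    then obtain V W where "?P a V" "?P b W" by blast
    then have "?P (a + b) (V \<union> W)" using tensor_kernel_closed(4)[OF mod T] by auto
    then show ?case by blast
  qed
qed

lemma module_transport:
  fixes A :: "('a, 'm) module" and g :: "'m \<Rightarrow> 'n"
  assumes "module R A" and inj: "inj_on g (carrier A)"
  shows "\<exists>B :: ('a, 'n) module. module R B \<and> g \<in> mod_hom R A B"
proof -
  interpret A: module R A by fact
  let ?h = "inv_into (carrier A) g"
  define B :: "('a, 'n) module" where "B =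
    \<lparr>carrier = g ` carrier A, monoid.mult = undefined, one = undefined, ring.zero = g \<zero>\<^bsub>A\<^esub>,
     add = (\<lambda>u v. g (?h u \<oplus>\<^bsub>A\<^esub> ?h v)), smult = (\<lambda>a u. g (a \<odot>\<^bsub>A\<^esub> ?h u))\<rparr>"
  have h [simp]: "?h (g x) = x" if "x \<in> carrier A" for x
    using inj that by simp
  have "module R B"
  proof (rule moduleI)
    show "abelian_group B"
    proof (rule abelian_groupI)
      fix u assume "u \<in> carrier B"
      then obtain x where x: "x \<in> carrier A" "u = g x" by (auto simp: B_def)
      then show "\<exists>v\<in>carrier B. v \<oplus>\<^bsub>B\<^esub> u = \<zero>\<^bsub>B\<^esub>"
        by (intro bexI[of _ "g (\<ominus>\<^bsub>A\<^esub> x)"]) (auto simp: B_def A.M.l_neg)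
    qed (auto simp: B_def A.M.a_ac)
  qed (auto simp: B_def A.R.cring_axioms A.smult_l_distr A.smult_r_distr A.smult_assoc1)
  moreover have "g \<in> mod_hom R A B"
    by (auto simp: mod_hom_def B_def)
  ultimately show ?thesis by blast
qed

lemma finitely_generated_submodule:
  fixes N :: "('a, 'n) module"
  assumes "module R N" and W: "finite W" "W \<subseteq> carrier N"
  shows "\<exists>H (g :: 'n \<Rightarrow> (nat \<Rightarrow> 'a) set). submodule H R N \<and> W \<subseteq> H \<and> inj_on g H"
proof -
  interpret N: module R N by fact
  obtain w :: "nat \<Rightarrow> 'n" and k where w: "bij_betw w {..<k} W"
    using ex_bij_betw_nat_finite[OF W(1)] by (auto simp: atLeast0LessThan)
  have wc: "w i \<in> carrier N" if "i < k" for i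
    using w W(2) that by (auto simp: bij_betw_def)
  define C where "C = {..<k} \<rightarrow> carrier R"
  define L where "L = (\<lambda>c. \<Oplus>\<^bsub>N\<^esub>i\<in>{..<k}. c i \<odot>\<^bsub>N\<^esub> w i)"
  have Lc: "L c \<in> carrier N" if "c \<in> C" for c
    using that wc unfolding L_def C_def by (intro N.M.finsum_closed) auto
  have Ladd: "L (\<lambda>i. c i \<oplus>\<^bsub>R\<^esub> c' i) = L c \<oplus>\<^bsub>N\<^esub> L c'" if "c \<in> C" "c' \<in> C" for c c'
  proof -
    have "L c \<oplus>\<^bsub>N\<^esub> L c' = (\<Oplus>\<^bsub>N\<^esub>i\<in>{..<k}. c i \<odot>\<^bsub>N\<^esub> w i \<oplus>\<^bsub>N\<^esub> c' i \<odot>\<^bsub>N\<^esub> w i)"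
      unfolding L_def using that wc by (intro N.M.finsum_addf[symmetric]) (auto simp: C_def)
    also have "\<dots> = L (\<lambda>i. c i \<oplus>\<^bsub>R\<^esub> c' i)"
      unfolding L_def using that wc
      by (intro N.M.finsum_cong') (auto simp: C_def Pi_iff N.smult_l_distr)
    finally show ?thesis by simp
  qed
  have Lsmult: "L (\<lambda>i. a \<otimes>\<^bsub>R\<^esub> c i) = a \<odot>\<^bsub>N\<^esub> L c" if "c \<in> C" "a \<in> carrier R" for a c
  proof -
    have "a \<odot>\<^bsub>N\<^esub> L c = (\<Oplus>\<^bsub>N\<^esub>i\<in>{..<k}. a \<odot>\<^bsub>N\<^esub> (c i \<odot>\<^bsub>N\<^esub> w i))"
      unfolding L_def using that wc by (intro N.finsum_smult_ldistr) (auto simp: C_def)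
    also have "\<dots> = L (\<lambda>i. a \<otimes>\<^bsub>R\<^esub> c i)"
      unfolding L_def using that wc
      by (intro N.M.finsum_cong') (auto simp: C_def Pi_iff N.smult_assoc1)
    finally show ?thesis by simp
  qed
  have smult: "a \<odot>\<^bsub>N\<^esub> x \<in> L ` C" if "a \<in> carrier R" "x \<in> L ` C" for a x
  proof -
    from that obtain c where c: "c \<in> C" "x = L c" by blast
    have "(\<lambda>i. a \<otimes>\<^bsub>R\<^esub> c i) \<in> C" using c that by (auto simp: C_def)
    then show ?thesis using Lsmult[OF c(1) that(1)] c(2) by (metis imageI)
  qed
  have "submodule (L ` C) R N"
  proof (rule N.submoduleI)
    show "L ` C \<subseteq> carrier N" using Lc by blast
    have "(\<lambda>i. \<zero>\<^bsub>R\<^esub>) \<in> C" by (simp add: C_def)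
    then show "\<zero>\<^bsub>N\<^esub> \<in> L ` C"
      using smult[of "\<zero>\<^bsub>R\<^esub>" "L (\<lambda>i. \<zero>\<^bsub>R\<^esub>)"] Lc by auto
    show "\<ominus>\<^bsub>N\<^esub> x \<in> L ` C" if "x \<in> L ` C" for x
      using smult[OF _ that, of "\<ominus>\<^bsub>R\<^esub> \<one>\<^bsub>R\<^esub>"] that Lc by (auto simp: N.smult_l_minus)
    show "x \<oplus>\<^bsub>N\<^esub> y \<in> L ` C" if xy: "x \<in> L ` C" "y \<in> L ` C" for x y
    proof -
      from xy obtain c c' where c: "c \<in> C" "x = L c" "c' \<in> C" "y = L c'" by blast
      have "(\<lambda>i. c i \<oplus>\<^bsub>R\<^esub> c' i) \<in> C" using c by (auto simp: C_def)
      then show ?thesis using Ladd[OF c(1,3)] c by (metis imageI)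
    qed
  qed (rule smult)
  moreover have "W \<subseteq> L ` C"
  proof
    fix x assume "x \<in> W"
    then obtain j where j: "j < k" "x = w j" using w by (auto simp: bij_betw_def)
    let ?c = "\<lambda>i. if j = i then \<one>\<^bsub>R\<^esub> else \<zero>\<^bsub>R\<^esub>"
    have "L ?c = (\<Oplus>\<^bsub>N\<^esub>i\<in>{..<k}. if j = i then w i else \<zero>\<^bsub>N\<^esub>)"
      unfolding L_def using wc by (intro N.M.finsum_cong') auto
    also have "\<dots> = w j"
      using j wc by (intro N.M.finsum_singleton) auto
    finally show "x \<in> L ` C" using j by (auto simp: C_def intro!: image_eqI[of _ _ ?c])
  qed
  moreover have "inj_on (\<lambda>x. {c \<in> C. L c = x}) (L ` C)"
    by (rule inj_onI) blast
  ultimately show ?thesis by blast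
qed

lemma base_change_unit_eq_iff:
  assumes "cring R" "cring S" "f \<in> ring_hom R S" "module R M"
    and "x \<in> carrier M" "y \<in> carrier M"
  shows "base_change_unit R S f M x = base_change_unit R S f M y \<longleftrightarrow>
    frag_of (x, \<one>\<^bsub>S\<^esub>) - frag_of (y, \<one>\<^bsub>S\<^esub>) \<in> tensor_kernel R M (restrict_scalars S f)"
proof -
  interpret S: cring S by fact
  have "\<one>\<^bsub>S\<^esub> \<in> carrier (restrict_scalars S f)" by (simp add: restrict_scalars_def)
  then show ?thesis
    unfolding base_change_unit_def using assms
    by (intro tensor_class_eq_iff module_restrict_scalars) (simp_all add: keys_frag_of)
qed

theorem pure_extension_every_module:
  fixes N :: "('a, 'n) module"
  assumes "cring R" "cring S" and pure: "pure_extension R S f" and N: "module R N"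
  shows "inj_on (base_change_unit R S f N) (carrier N)"
proof (rule inj_onI)
  fix x y
  assume x: "x \<in> carrier N" and y: "y \<in> carrier N"
    and eq: "base_change_unit R S f N x = base_change_unit R S f N y"
  let ?T = "restrict_scalars S f" and ?z = "frag_of (x, \<one>\<^bsub>S\<^esub>) - frag_of (y, \<one>\<^bsub>S\<^esub>)"
  have f: "f \<in> ring_hom R S" using pure by (simp add: pure_extension_def)
  note T = module_restrict_scalars[OF assms(1,2) f]
  have "?z \<in> tensor_kernel R N ?T"
    using base_change_unit_eq_iff[OF assms(1,2) f N x y] eq by simp
  from tensor_kernel_finite_support[OF N T this] obtain W where W: "finite W" "W \<subseteq> carrier N"
    and ker: "\<forall>H. submodule H R N \<and> W \<subseteq> H \<longrightarrow> ?z \<in> tensor_kernel R (N\<lparr>carrier := H\<rparr>) ?T"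
    by (elim exE conjE)
  have "finite (insert x (insert y W))" "insert x (insert y W) \<subseteq> carrier N"
    using W x y by simp_all
  from finitely_generated_submodule[OF N this]
  obtain H and g :: "'n \<Rightarrow> (nat \<Rightarrow> 'a) set"
    where H: "submodule H R N" and sub: "insert x (insert y W) \<subseteq> H" and inj: "inj_on g H"
    by (elim exE conjE)
  have xy: "x \<in> H" "y \<in> H" "W \<subseteq> H" using sub by simp_all
  let ?A = "N\<lparr>carrier := H\<rparr>"
  have A: "module R ?A" using submodule.submodule_is_module[OF H N] .
  have "inj_on g (carrier ?A)" using inj by simp
  from module_transport[OF A this]
  obtain B :: "('a, (nat \<Rightarrow> 'a) set) module" where B: "module R B" and g: "g \<in> mod_hom R ?A B"
    by (elim exE conjE)
  have gB: "g x \<in> carrier B" "g y \<in> carrier B"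
    using g xy by (simp_all add: mod_hom_def Pi_iff)
  have "?z \<in> tensor_kernel R ?A ?T"
    using ker H xy(3) by simp
  from tensor_kernel_map[OF A B T g this]
  have "base_change_unit R S f B (g x) = base_change_unit R S f B (g y)"
    by (simp add: base_change_unit_eq_iff[OF assms(1,2) f B gB] frag_extend_diff)
  moreover have "inj_on (base_change_unit R S f B) (carrier B)"
    using pure B by (simp add: pure_extension_def)
  ultimately have "g x = g y" using gB by (simp add: inj_on_eq_iff)
  then show "x = y" using inj xy by (simp add: inj_on_eq_iff)
qed


section \<open>Local cohomology\<close>

text \<open>
  The test modules again live in a fixed type; it contains \<open>R\<close> and its ideals (up to isomorphism),
  so by Baer's criterion this is injectivity with respect to all \<open>R\<close>-modules.
\<close>

definition injective_module :: "('a, 'r) ring_scheme \<Rightarrow> ('a, 'e) module \<Rightarrow> bool" where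
  "injective_module R E \<longleftrightarrow> module R E \<and>
     (\<forall>(A :: ('a, (nat \<Rightarrow> 'a) set) module) (B :: ('a, (nat \<Rightarrow> 'a) set) module) g h.
        module R A \<and> module R B \<and> g \<in> mod_hom R A B \<and> inj_on g (carrier A) \<and>
        h \<in> mod_hom R A E \<longrightarrow>
        (\<exists>k \<in> mod_hom R B E. \<forall>x \<in> carrier A. k (g x) = h x))"

text \<open>\<open>0 \<rightarrow> M \<rightarrow> E 0 \<rightarrow> E 1 \<rightarrow> \<dots>\<close> with augmentation \<open>\<epsilon>\<close> and differentials \<open>d n : E n \<rightarrow> E (n + 1)\<close>.\<close>

definition injective_resolution ::
    "('a, 'r) ring_scheme \<Rightarrow> ('a, 'm) module \<Rightarrow> (nat \<Rightarrow> ('a, 'e) module) \<Rightarrow> (nat \<Rightarrow> 'e \<Rightarrow> 'e) \<Rightarrow> ('m \<Rightarrow> 'e) \<Rightarrow> bool" where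
  "injective_resolution R M E d \<epsilon> \<longleftrightarrow>
     (\<forall>n. injective_module R (E n)) \<and>
     (\<forall>n. d n \<in> mod_hom R (E n) (E (Suc n))) \<and>
     \<epsilon> \<in> mod_hom R M (E 0) \<and> inj_on \<epsilon> (carrier M) \<and>
     \<epsilon> ` carrier M = {x \<in> carrier (E 0). d 0 x = \<zero>\<^bsub>E 1\<^esub>} \<and>
     (\<forall>n. d n ` carrier (E n) = {x \<in> carrier (E (Suc n)). d (Suc n) x = \<zero>\<^bsub>E (Suc (Suc n))\<^esub>})"

definition torsion_part :: "('a, 'r) ring_scheme \<Rightarrow> 'a set \<Rightarrow> ('a, 'm) module \<Rightarrow> 'm set" where
  "torsion_part R I M =
     {x \<in> carrier M. \<exists>n::nat. \<forall>a \<in> I [^]\<^bsub>ideals_set R\<^esub> n. a \<odot>\<^bsub>M\<^esub> x = \<zero>\<^bsub>M\<^esub>}"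

text \<open>
  \<open>H\<^sup>i\<^sub>I(M)\<close> as the \<open>i\<close>-th right derived functor of \<open>\<Gamma>\<^sub>I\<close> (\<open>torsion_part\<close>), computed from an injective
  resolution \<open>(E, d)\<close> of \<open>M\<close>: the \<open>i\<close>-th cohomology of \<open>\<Gamma>\<^sub>I (E 0) \<rightarrow> \<Gamma>\<^sub>I (E 1) \<rightarrow> \<dots>\<close>.
\<close>

definition local_cohomology ::
    "('a, 'r) ring_scheme \<Rightarrow> 'a set \<Rightarrow> (nat \<Rightarrow> ('a, 'e) module) \<Rightarrow> (nat \<Rightarrow> 'e \<Rightarrow> 'e) \<Rightarrow> nat \<Rightarrow> ('a, 'e set) module" where
  "local_cohomology R I E d i =
     quotient_module
       ((E i)\<lparr>carrier := {x \<in> torsion_part R I (E i). d i x = \<zero>\<^bsub>E (Suc i)\<^esub>}\<rparr>)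
       (case i of 0 \<Rightarrow> {\<zero>\<^bsub>E 0\<^esub>} | Suc j \<Rightarrow> d j ` torsion_part R I (E j))"

end

theory Submission imports Defs begin

text \<open>
  The support descends because it can be computed explicitly, for every \<open>R\<close>-module \<open>N\<close> and not only
  for local cohomology: if the support of \<open>N \<otimes>\<^sub>R S\<close> is the set \<open>V(J)\<close> of the primes of \<open>S\<close> containing
  \<open>J\<close>, then the support of \<open>N\<close> is the set of the primes of \<open>R\<close> containing the contraction
  \<open>f\<^sup>-\<^sup>1(J)\<close> (\<open>Supp_descends\<close>). Throughout, a prime lies in the support of a module exactly when it
  contains the annihilator of some element (\<open>Supp_iff_annihilator\<close>).

  Let \<open>P\<close> contain the annihilator of \<open>x \<in> N\<close>, and let \<open>f a \<in> J\<close>. Then \<open>f a\<close> lies in every prime of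
  the support of \<open>N \<otimes> S\<close>, so a power of it kills \<open>x \<otimes> 1\<close> (\<open>power_annihilates\<close>); that is,
  \<open>a\<^sup>n x \<otimes> 1 = 0\<close>. Purity gives \<open>a\<^sup>n x = 0\<close>, hence \<open>a\<^sup>n \<in> P\<close> and \<open>a \<in> P\<close>.

  Conversely, let \<open>P\<close> contain \<open>f\<^sup>-\<^sup>1(J)\<close>. Then \<open>J\<close> is disjoint from the multiplicative set
  \<open>f(R - P)\<close>, so some prime \<open>Q\<close> containing \<open>J\<close> is disjoint from it too (\<open>prime_ideal_avoiding\<close>).
  This \<open>Q\<close> belongs to the support of \<open>N \<otimes> S\<close>. If \<open>P\<close> were not in the support of \<open>N\<close>, every element
  of \<open>N\<close> would be killed by an element of \<open>R - P\<close>; since an element of \<open>N \<otimes> S\<close> involves only finitely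
  many elements of \<open>N\<close>, it would be killed by an element of \<open>f(R - P)\<close>, which avoids \<open>Q\<close>
  (\<open>base_change_killed\<close>), a contradiction.

  What remains is to see that \<open>H\<^sup>i\<^sub>I(M)\<close> is an \<open>R\<close>-module, \<open>module_local_cohomology\<close>, and that
  \<open>N \<otimes>\<^sub>R S\<close> is an \<open>S\<close>-module, \<open>module_base_change\<close>.
\<close>

section \<open>Supports and annihilators\<close>

lemma (in primeideal) complement_multiplicative:
  "\<one> \<in> carrier R - I"
  "a \<in> carrier R - I \<Longrightarrow> b \<in> carrier R - I \<Longrightarrow> a \<otimes> b \<in> carrier R - I"
  using I_notcarr one_imp_carrier I_prime by auto

text \<open>
  A fraction \<open>x / s\<close> whose numerator is killed by an element outside \<open>P\<close> is the set of all such
  pairs. The right-hand side does not mention \<open>x\<close> and \<open>s\<close>, so all these fractions are equal to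
  each other, and in particular to \<open>0 / 1\<close>.
\<close>

lemma fraction_eq_if_killed:
  assumes "module R M" and P: "primeideal P R"
    and x: "x \<in> carrier M" and s: "s \<in> carrier R - P"
    and u: "u \<in> carrier R - P" and ux: "u \<odot>\<^bsub>M\<^esub> x = \<zero>\<^bsub>M\<^esub>"
  shows "fraction R M P x s =
    {(y, t). y \<in> carrier M \<and> t \<in> carrier R - P \<and> (\<exists>v \<in> carrier R - P. v \<odot>\<^bsub>M\<^esub> y = \<zero>\<^bsub>M\<^esub>)}"
proof -
  interpret module R M by fact
  note mult = primeideal.complement_multiplicative(2)[OF P]
  have "(\<exists>v \<in> carrier R - P. v \<odot>\<^bsub>M\<^esub> (t \<odot>\<^bsub>M\<^esub> x) = v \<odot>\<^bsub>M\<^esub> (s \<odot>\<^bsub>M\<^esub> y)) \<longleftrightarrow>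
      (\<exists>v \<in> carrier R - P. v \<odot>\<^bsub>M\<^esub> y = \<zero>\<^bsub>M\<^esub>)" (is "?L \<longleftrightarrow> ?Z")
    if y: "y \<in> carrier M" and t: "t \<in> carrier R - P" for y t
  proof
    assume ?L
    then obtain v where v: "v \<in> carrier R - P" "v \<odot>\<^bsub>M\<^esub> (t \<odot>\<^bsub>M\<^esub> x) = v \<odot>\<^bsub>M\<^esub> (s \<odot>\<^bsub>M\<^esub> y)" by blast
    have "(u \<otimes>\<^bsub>R\<^esub> (v \<otimes>\<^bsub>R\<^esub> s)) \<odot>\<^bsub>M\<^esub> y = u \<odot>\<^bsub>M\<^esub> (v \<odot>\<^bsub>M\<^esub> (t \<odot>\<^bsub>M\<^esub> x))"
      using u v s y by (simp add: smult_assoc1)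
    also have "\<dots> = (v \<otimes>\<^bsub>R\<^esub> t) \<odot>\<^bsub>M\<^esub> (u \<odot>\<^bsub>M\<^esub> x)"
      using u v(1) t x by (simp add: smult_assoc1[symmetric] R.m_ac)
    also have "\<dots> = \<zero>\<^bsub>M\<^esub>" using v(1) t ux by simp
    finally show ?Z using mult[OF u mult[OF v(1) s]] by blast
  next
    assume ?Z
    then obtain v where v: "v \<in> carrier R - P" "v \<odot>\<^bsub>M\<^esub> y = \<zero>\<^bsub>M\<^esub>" by blast
    have "(u \<otimes>\<^bsub>R\<^esub> v) \<odot>\<^bsub>M\<^esub> (t \<odot>\<^bsub>M\<^esub> x) = (v \<otimes>\<^bsub>R\<^esub> t) \<odot>\<^bsub>M\<^esub> (u \<odot>\<^bsub>M\<^esub> x)"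
      using u v(1) t x by (simp add: smult_assoc1[symmetric] R.m_ac)
    also have "\<dots> = (u \<otimes>\<^bsub>R\<^esub> s) \<odot>\<^bsub>M\<^esub> (v \<odot>\<^bsub>M\<^esub> y)"
      using u v t s ux by simp
    also have "\<dots> = (u \<otimes>\<^bsub>R\<^esub> v) \<odot>\<^bsub>M\<^esub> (s \<odot>\<^bsub>M\<^esub> y)"
      using u v(1) s y by (simp add: smult_assoc1[symmetric] R.m_ac)
    finally show ?L using mult[OF u v(1)] by blast
  qed
  then show ?thesis
    using x s by (auto simp: fraction_def fraction_rel_def)
qed

lemma Supp_iff_annihilator:
  assumes "module R M"
  shows "P \<in> Supp R M \<longleftrightarrow>
    primeideal P R \<and> (\<exists>x \<in> carrier M. \<forall>s \<in> carrier R. s \<odot>\<^bsub>M\<^esub> x = \<zero>\<^bsub>M\<^esub> \<longrightarrow> s \<in> P)"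
proof (cases "primeideal P R")
  case P: True
  interpret module R M by fact
  note one = primeideal.complement_multiplicative(1)[OF P]
  let ?zero = "fraction R M P \<zero>\<^bsub>M\<^esub> \<one>\<^bsub>R\<^esub>"
  have zero: "?zero = {(y, t). y \<in> carrier M \<and> t \<in> carrier R - P \<and>
      (\<exists>v \<in> carrier R - P. v \<odot>\<^bsub>M\<^esub> y = \<zero>\<^bsub>M\<^esub>)}"
    using fraction_eq_if_killed[OF module_axioms P M.zero_closed one one] by simp
  have carr: "carrier (localization R M P) =
      {fraction R M P x s | x s. x \<in> carrier M \<and> s \<in> carrier R - P}"
    by (auto simp: localization_def quotient_def fraction_def)
  have mem: "(x, s) \<in> fraction R M P x s" if "x \<in> carrier M" "s \<in> carrier R - P" for x s
    using that one by (auto simp: fraction_def fraction_rel_def)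
  have carrI: "fraction R M P x s \<in> carrier (localization R M P)"
    if "x \<in> carrier M" "s \<in> carrier R - P" for x s
    using carr that by auto
  note zc = carrI[OF M.zero_closed one]
  have "carrier (localization R M P) \<noteq> {?zero} \<longleftrightarrow>
      (\<exists>x \<in> carrier M. \<forall>s \<in> carrier R - P. s \<odot>\<^bsub>M\<^esub> x \<noteq> \<zero>\<^bsub>M\<^esub>)" (is "?L \<longleftrightarrow> ?A")
  proof
    assume ?L
    then obtain A where A: "A \<in> carrier (localization R M P)" "A \<noteq> ?zero"
      using zc by (metis singletonI subsetI subset_singleton_iff empty_iff)
    from A(1) obtain x s where x: "x \<in> carrier M" "s \<in> carrier R - P" and "A = fraction R M P x s"
      unfolding carr by (elim CollectE exE conjE) simp
    then have ne: "fraction R M P x s \<noteq> ?zero" using A(2) by simp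
    have "u \<odot>\<^bsub>M\<^esub> x \<noteq> \<zero>\<^bsub>M\<^esub>" if "u \<in> carrier R - P" for u
      using fraction_eq_if_killed[OF module_axioms P x that] zero ne by argo
    then show ?A using x(1) by blast
  next
    assume ?A
    then obtain x where x: "x \<in> carrier M" "\<forall>s \<in> carrier R - P. s \<odot>\<^bsub>M\<^esub> x \<noteq> \<zero>\<^bsub>M\<^esub>" by blast
    then have "(x, \<one>\<^bsub>R\<^esub>) \<notin> ?zero" using zero by blast
    then have "fraction R M P x \<one>\<^bsub>R\<^esub> \<noteq> ?zero" using mem[OF x(1) one] by metis
    then show ?L using carrI[OF x(1) one] by auto
  qed
  moreover have "\<zero>\<^bsub>localization R M P\<^esub> = ?zero" by (simp add: localization_def)
  ultimately show ?thesis using P unfolding Supp_def Spec_def by auto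
qed (simp add: Supp_def Spec_def)

lemma ideal_annihilator:
  assumes "module R M" and x: "x \<in> carrier M"
  shows "ideal {a \<in> carrier R. a \<odot>\<^bsub>M\<^esub> x = \<zero>\<^bsub>M\<^esub>} R"
proof -
  interpret module R M by fact
  show ?thesis
  proof (rule idealI[OF R.ring_axioms])
    show "subgroup {a \<in> carrier R. a \<odot>\<^bsub>M\<^esub> x = \<zero>\<^bsub>M\<^esub>} (add_monoid R)"
    proof (rule R.add.subgroupI)
      show "{a \<in> carrier R. a \<odot>\<^bsub>M\<^esub> x = \<zero>\<^bsub>M\<^esub>} \<noteq> {}" using x by force
    qed (use x in \<open>auto simp: smult_l_distr smult_l_minus\<close>)
    fix a r assume a: "a \<in> {a \<in> carrier R. a \<odot>\<^bsub>M\<^esub> x = \<zero>\<^bsub>M\<^esub>}" and r: "r \<in> carrier R"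
    then show "r \<otimes>\<^bsub>R\<^esub> a \<in> {a \<in> carrier R. a \<odot>\<^bsub>M\<^esub> x = \<zero>\<^bsub>M\<^esub>}"
      using x by (simp add: smult_assoc1)
    then show "a \<otimes>\<^bsub>R\<^esub> r \<in> {a \<in> carrier R. a \<odot>\<^bsub>M\<^esub> x = \<zero>\<^bsub>M\<^esub>}"
      using a r R.m_comm[of a r] by simp
  qed
qed

text \<open>
  An ideal that is maximal among those containing \<open>J\<close> and disjoint from \<open>T\<close> is prime: if \<open>a\<close> and \<open>b\<close>
  lie outside it, adding either one produces an element of \<open>T\<close>, and the product of these two elements
  of \<open>T\<close> would lie in the ideal if \<open>a b\<close> did.
\<close>

lemma (in noetherian_ring) prime_ideal_avoiding:
  assumes "cring R" and J: "ideal J R"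
    and T: "T \<subseteq> carrier R" "\<one> \<in> T" "\<And>s t. s \<in> T \<Longrightarrow> t \<in> T \<Longrightarrow> s \<otimes> t \<in> T"
    and disj: "J \<inter> T = {}"
  obtains Q where "primeideal Q R" "J \<subseteq> Q" "Q \<inter> T = {}"
proof -
  interpret cring R by fact
  let ?A = "{K. ideal K R \<and> J \<subseteq> K \<and> K \<inter> T = {}}"
  have "\<exists>Q\<in>?A. \<forall>K\<in>?A. Q \<subseteq> K \<longrightarrow> K = Q"
  proof (rule subset_Zorn_nonempty)
    show "?A \<noteq> {}" using J disj by blast
    fix C assume C: "C \<noteq> {}" "subset.chain ?A C"
    then have "subset.chain {K. ideal K R} C" by (auto simp: subset_chain_def)
    then have "\<Union>C \<in> C" using ideal_chain_is_trivial[OF C(1)] by blast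
    then show "\<Union>C \<in> ?A" using C(2) by (auto simp: subset_chain_def)
  qed
  then obtain Q where Q: "ideal Q R" "J \<subseteq> Q" "Q \<inter> T = {}"
    and max: "\<And>K. ideal K R \<Longrightarrow> Q \<subseteq> K \<Longrightarrow> K \<inter> T = {} \<Longrightarrow> K = Q"
    by auto
  interpret Q: ideal Q R by fact
  have meet: "\<exists>q \<in> Q. \<exists>r \<in> carrier R. q \<oplus> r \<otimes> a \<in> T" if a: "a \<in> carrier R" "a \<notin> Q" for a
  proof -
    have id: "ideal (Q <+> PIdl a) R" by (intro add_ideals cgenideal_ideal a Q)
    have sum: "q \<oplus> r \<otimes> a \<in> Q <+> PIdl a" if "q \<in> Q" "r \<in> carrier R" for q r
      using that by (auto simp: set_add_def' cgenideal_def)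
    have "\<zero> \<oplus> \<one> \<otimes> a \<in> Q <+> PIdl a" by (intro sum) auto
    moreover have "Q \<subseteq> Q <+> PIdl a"
      using sum[of _ \<zero>] a by fastforce
    ultimately have "(Q <+> PIdl a) \<inter> T \<noteq> {}"
      using max[OF id] a by auto
    then show ?thesis by (auto simp: set_add_def' cgenideal_def)
  qed
  have "primeideal Q R"
  proof (rule primeidealI)
    show "carrier R \<noteq> Q" using Q(3) T(1,2) by blast
    fix a b assume ab: "a \<in> carrier R" "b \<in> carrier R" "a \<otimes> b \<in> Q"
    show "a \<in> Q \<or> b \<in> Q"
    proof (rule ccontr)
      assume "\<not> (a \<in> Q \<or> b \<in> Q)"
      then obtain q r q' r' where qr: "q \<in> Q" "r \<in> carrier R" "q \<oplus> r \<otimes> a \<in> T"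
        "q' \<in> Q" "r' \<in> carrier R" "q' \<oplus> r' \<otimes> b \<in> T"
        using meet ab by meson
      have c: "q \<in> carrier R" "q' \<in> carrier R" using qr(1,4) Q.Icarr by simp_all
      have "q \<otimes> (q' \<oplus> r' \<otimes> b) \<in> Q" "(r \<otimes> a) \<otimes> q' \<in> Q" "(r \<otimes> r') \<otimes> (a \<otimes> b) \<in> Q"
        using qr(1,2,4,5) ab c by (simp_all add: Q.I_r_closed Q.I_l_closed)
      moreover have "(q \<oplus> r \<otimes> a) \<otimes> (q' \<oplus> r' \<otimes> b) =
          q \<otimes> (q' \<oplus> r' \<otimes> b) \<oplus> ((r \<otimes> a) \<otimes> q' \<oplus> (r \<otimes> r') \<otimes> (a \<otimes> b))"
        using qr(2,5) ab(1,2) c by (simp add: l_distr r_distr m_ac)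
      ultimately have "(q \<oplus> r \<otimes> a) \<otimes> (q' \<oplus> r' \<otimes> b) \<in> Q" by simp
      then show False using T(3)[OF qr(3,6)] Q(3) by auto
    qed
  qed (fact Q(1) cring_axioms)+
  then show thesis using that Q by blast
qed

text \<open>
  Every prime containing the annihilator of \<open>x\<close> belongs to the support, and an element of all primes
  containing an ideal has a power in that ideal.
\<close>

lemma power_annihilates:
  assumes "module R M" and "noetherian_ring R" and x: "x \<in> carrier M" and c: "c \<in> carrier R"
    and all: "\<And>Q. Q \<in> Supp R M \<Longrightarrow> c \<in> Q"
  shows "\<exists>n::nat. c [^]\<^bsub>R\<^esub> n \<odot>\<^bsub>M\<^esub> x = \<zero>\<^bsub>M\<^esub>"
proof (rule ccontr)
  assume no: "\<not> ?thesis"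
  interpret module R M by fact
  interpret noetherian_ring R by fact
  let ?Ann = "{a \<in> carrier R. a \<odot>\<^bsub>M\<^esub> x = \<zero>\<^bsub>M\<^esub>}"
  let ?T = "range (\<lambda>n::nat. c [^]\<^bsub>R\<^esub> n)"
  have T: "s \<otimes>\<^bsub>R\<^esub> t \<in> ?T" if "s \<in> ?T" "t \<in> ?T" for s t
    using that R.nat_pow_mult[OF c] by auto
  have T1: "\<one>\<^bsub>R\<^esub> \<in> ?T" "c \<in> ?T"
    using c R.nat_pow_0 R.nat_pow_eone by (metis rangeI)+
  have "?Ann \<inter> ?T = {}" using no by auto
  then obtain Q where Q: "primeideal Q R" "?Ann \<subseteq> Q" "Q \<inter> ?T = {}"
    using prime_ideal_avoiding[OF R.is_cring ideal_annihilator[OF module_axioms x], of ?T] c T T1 by blast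
  then have "Q \<in> Supp R M"
    unfolding Supp_iff_annihilator[OF module_axioms] using x by blast
  then show False using all T1(2) Q(3) by blast
qed

section \<open>Base change as a module\<close>

context
  fixes R :: "('a, 'r) ring_scheme" and S :: "('b, 's) ring_scheme" and f :: "'a \<Rightarrow> 'b"
    and N :: "('a, 'n) module"
  assumes R: "cring R" and S: "cring S" and f: "f \<in> ring_hom R S" and N: "module R N"
begin

interpretation R: cring R by (fact R)
interpretation S: cring S by (fact S)
interpretation N: module R N by (fact N)

private abbreviation (input) T where "T \<equiv> restrict_scalars S f"
private abbreviation (input) ker where "ker \<equiv> tensor_kernel R N T"
private abbreviation (input) cls where "cls \<equiv> tensor_class R N T"
private abbreviation (input) "B \<equiv> base_change R S f N"
private abbreviation (input) "F s \<equiv> frag_extend (\<lambda>(x, t). frag_of (x, s \<otimes>\<^bsub>S\<^esub> t))"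

private lemma module_T: "module R T"
  by (rule module_restrict_scalars[OF R S f])

private lemma T_simps [simp]:
  "carrier T = carrier S" "a \<odot>\<^bsub>T\<^esub> t = f a \<otimes>\<^bsub>S\<^esub> t" "t \<oplus>\<^bsub>T\<^esub> t' = t \<oplus>\<^bsub>S\<^esub> t'"
  by (simp_all add: restrict_scalars_def)

private lemmas ker_closed = tensor_kernel_closed[OF N module_T]

private lemma ker_diff: "a \<in> ker \<Longrightarrow> b \<in> ker \<Longrightarrow> a - b \<in> ker"
  using ker_closed(4)[OF _ ker_closed(3)] by fastforce

private lemmas cls_eq_iff = tensor_class_eq_iff[OF N module_T, unfolded T_simps]

private lemma keys_F:
  assumes "s \<in> carrier S" "Poly_Mapping.keys c \<subseteq> carrier N \<times> carrier S"
  shows "Poly_Mapping.keys (F s c) \<subseteq> carrier N \<times> carrier S"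
proof -
  have "Poly_Mapping.keys (F s c) \<subseteq> (\<lambda>(x, t). (x, s \<otimes>\<^bsub>S\<^esub> t)) ` Poly_Mapping.keys c"
    by (rule order_trans[OF keys_frag_extend]) (force simp: keys_frag_of)
  also have "\<dots> \<subseteq> carrier N \<times> carrier S" using assms by auto
  finally show ?thesis .
qed

text \<open>Multiplication by \<open>s\<close> is well defined on \<open>N \<otimes> S\<close>, because it maps relators to relators of the same kind.\<close>

private lemma F_ker:
  assumes s: "s \<in> carrier S" and c: "c \<in> ker"
  shows "F s c \<in> ker"
proof -
  have rel: "F s r \<in> ker" if "r \<in> tensor_relators R N T" for r
  proof -
    from that have "F s r \<in> tensor_relators R N T"
    proof (cases rule: tensor_relators_cases)
      case (add_left x x' y)
      then show ?thesis
        using s tensor_relators_memI(1)[of x N x' "s \<otimes>\<^bsub>S\<^esub> y" T R] by (simp add: frag_extend_diff)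
    next
      case (add_right x y y')
      then show ?thesis
        using s tensor_relators_memI(2)[of x N "s \<otimes>\<^bsub>S\<^esub> y" T "s \<otimes>\<^bsub>S\<^esub> y'" R]
        by (simp add: frag_extend_diff S.r_distr)
    next
      case (smult a x y)
      moreover have "s \<otimes>\<^bsub>S\<^esub> (f a \<otimes>\<^bsub>S\<^esub> y) = f a \<otimes>\<^bsub>S\<^esub> (s \<otimes>\<^bsub>S\<^esub> y)"
        using smult s ring_hom_closed[OF f] by (simp add: S.m_lcomm)
      ultimately show ?thesis
        using s tensor_relators_memI(3)[of a R x N "s \<otimes>\<^bsub>S\<^esub> y" T] by (simp add: frag_extend_diff)
    qed
    then show ?thesis by (rule ker_closed(2))
  qed
  show ?thesis
    using N module_T c
  proof (induction c rule: tensor_kernel_induct)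
    case (uminus r)
    then show ?case by (simp add: frag_extend_minus ker_closed(3) rel)
  qed (simp_all add: frag_extend_add ker_closed(1,4) rel)
qed

private lemma carrier_B: "carrier B = cls ` {c. Poly_Mapping.keys c \<subseteq> carrier N \<times> carrier S}"
  by (auto simp: base_change_def tensor_group_def tensor_class_def carrier_FactGroup)

private lemma cls_mem:
  assumes "c' \<in> cls c" "Poly_Mapping.keys c \<subseteq> carrier N \<times> carrier S"
  shows "Poly_Mapping.keys c' \<subseteq> carrier N \<times> carrier S \<and> c' - c \<in> ker"
proof -
  obtain k where k: "k \<in> ker" "c' = k + c"
    using assms(1) by (auto simp: tensor_class_def r_coset_def)
  have "Poly_Mapping.keys k \<subseteq> carrier N \<times> carrier S"
    using subgroup.mem_carrier[OF subgroup_tensor_kernel[OF N module_T] k(1)] by simp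
  then show ?thesis using k assms(2) keys_add[of k c] by auto
qed

private lemma cls_self:
  assumes "Poly_Mapping.keys c \<subseteq> carrier N \<times> carrier S"
  shows "c \<in> cls c"
  using group.rcos_self[OF group_free_Abelian_group _ subgroup_tensor_kernel[OF N module_T], of c] assms
  by (simp add: tensor_class_def)

private lemma smult_cls:
  assumes s: "s \<in> carrier S" and c: "Poly_Mapping.keys c \<subseteq> carrier N \<times> carrier S"
  shows "s \<odot>\<^bsub>B\<^esub> cls c = cls (F s c)"
proof -
  have "cls (F s c') = cls (F s c)" if "c' \<in> cls c" for c'
    using cls_mem[OF that c] s c F_ker[OF s, of "c' - c"]
    by (simp add: cls_eq_iff keys_F frag_extend_diff)
  then have "(\<Union>c' \<in> cls c. cls (F s c')) = cls (F s c)"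
    using cls_self[OF c] by (intro SUP_eq_const) blast+
  then show ?thesis by (simp add: base_change_def)
qed

private lemma add_cls:
  assumes "Poly_Mapping.keys c \<subseteq> carrier N \<times> carrier S" "Poly_Mapping.keys c' \<subseteq> carrier N \<times> carrier S"
  shows "cls c \<oplus>\<^bsub>B\<^esub> cls c' = cls (c + c')"
proof -
  have "normal ker (free_Abelian_group (carrier N \<times> carrier T))"
    using comm_group.normal_iff_subgroup[OF abelian_free_Abelian_group] subgroup_tensor_kernel[OF N module_T] by blast
  from normal.rcos_sum[OF this, of c c'] show ?thesis
    using assms by (simp add: base_change_def tensor_group_def tensor_class_def FactGroup_def)
qed

private lemma zero_B: "\<zero>\<^bsub>B\<^esub> = cls 0"
proof -
  have "ker \<subseteq> carrier (free_Abelian_group (carrier N \<times> carrier T))"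
    by (rule subgroup.subset[OF subgroup_tensor_kernel[OF N module_T]])
  from group.coset_mult_one[OF group_free_Abelian_group this]
  have "ker #>\<^bsub>free_Abelian_group (carrier N \<times> carrier T)\<^esub> 0 = ker" by simp
  then show ?thesis by (simp add: base_change_def tensor_group_def tensor_class_def)
qed

text \<open>
  Additivity in the scalar holds only modulo the relators; the other module laws already hold for
  formal sums of pairs.
\<close>

private lemma F_add_ker:
  assumes "s \<in> carrier S" "s' \<in> carrier S" "Poly_Mapping.keys c \<subseteq> carrier N \<times> carrier S"
  shows "F (s \<oplus>\<^bsub>S\<^esub> s') c - (F s c + F s' c) \<in> ker"
  using assms(3)
proof (induction c rule: frag_induction)
  case zero
  show ?case by (simp add: ker_closed)
next
  case (one p)
  obtain x t where p: "p = (x, t)" by force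
  then show ?case
    using one assms ker_closed(2)[OF tensor_relators_memI(2)[of x N "s \<otimes>\<^bsub>S\<^esub> t" T "s' \<otimes>\<^bsub>S\<^esub> t" R]]
    by (simp add: S.l_distr diff_diff_eq)
next
  case (diff a b)
  from ker_diff[OF this] show ?case by (simp add: frag_extend_diff algebra_simps)
qed

private lemma F_mult:
  assumes "s \<in> carrier S" "s' \<in> carrier S" "Poly_Mapping.keys c \<subseteq> carrier N \<times> carrier S"
  shows "F (s \<otimes>\<^bsub>S\<^esub> s') c = F s (F s' c)"
  using assms(3)
  by (induction c rule: frag_induction) (use assms in \<open>auto simp: frag_extend_diff S.m_assoc\<close>)

private lemma F_one:
  assumes "Poly_Mapping.keys c \<subseteq> carrier N \<times> carrier S"
  shows "F \<one>\<^bsub>S\<^esub> c = c"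
  using assms by (induction c rule: frag_induction) (auto simp: frag_extend_diff)

lemma module_base_change: "module S (base_change R S f N)"
proof (rule moduleI)
  have "comm_group (tensor_group R N T)"
    unfolding tensor_group_def
    by (intro comm_group.abelian_FactGroup abelian_free_Abelian_group subgroup_tensor_kernel N module_T)
  then interpret G: comm_group "tensor_group R N T" .
  show "abelian_group B"
  proof (rule abelian_groupI)
    show "y \<oplus>\<^bsub>B\<^esub> z = z \<oplus>\<^bsub>B\<^esub> y" if "y \<in> carrier B" "z \<in> carrier B" for y z
      using that G.m_comm by (simp add: base_change_def)
  qed (auto simp: base_change_def G.m_assoc intro: G.l_inv_ex)
  have add: "Poly_Mapping.keys (c + c') \<subseteq> carrier N \<times> carrier S"
    if "Poly_Mapping.keys c \<subseteq> carrier N \<times> carrier S"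
      "Poly_Mapping.keys c' \<subseteq> carrier N \<times> carrier S" for c c'
    using order_trans[OF keys_add[of c c'] Un_least[OF that]] .
  show "s \<odot>\<^bsub>B\<^esub> z \<in> carrier B" if "s \<in> carrier S" "z \<in> carrier B" for s z
    using that keys_F by (auto simp: carrier_B smult_cls)
  show "(s \<oplus>\<^bsub>S\<^esub> s') \<odot>\<^bsub>B\<^esub> z = s \<odot>\<^bsub>B\<^esub> z \<oplus>\<^bsub>B\<^esub> s' \<odot>\<^bsub>B\<^esub> z"
    if "s \<in> carrier S" "s' \<in> carrier S" "z \<in> carrier B" for s s' z
  proof -
    obtain c where c: "Poly_Mapping.keys c \<subseteq> carrier N \<times> carrier S" "z = cls c"
      using \<open>z \<in> carrier B\<close> by (auto simp: carrier_B)
    have "cls (F (s \<oplus>\<^bsub>S\<^esub> s') c) = cls (F s c + F s' c)"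
      using that(1,2) c(1) by (subst cls_eq_iff) (simp_all add: keys_F add F_add_ker)
    then show ?thesis using that(1,2) c by (simp add: smult_cls add_cls keys_F)
  qed
  show "s \<odot>\<^bsub>B\<^esub> (y \<oplus>\<^bsub>B\<^esub> z) = s \<odot>\<^bsub>B\<^esub> y \<oplus>\<^bsub>B\<^esub> s \<odot>\<^bsub>B\<^esub> z"
    if "s \<in> carrier S" "y \<in> carrier B" "z \<in> carrier B" for s y z
    using that by (auto simp: carrier_B smult_cls add_cls keys_F add frag_extend_add)
  show "(s \<otimes>\<^bsub>S\<^esub> s') \<odot>\<^bsub>B\<^esub> z = s \<odot>\<^bsub>B\<^esub> (s' \<odot>\<^bsub>B\<^esub> z)"
    if "s \<in> carrier S" "s' \<in> carrier S" "z \<in> carrier B" for s s' z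
    using that by (auto simp: carrier_B smult_cls keys_F F_mult)
  show "\<one>\<^bsub>S\<^esub> \<odot>\<^bsub>B\<^esub> z = z" if "z \<in> carrier B" for z
    using that by (auto simp: carrier_B smult_cls F_one)
qed (fact S)

lemma base_change_unit_closed: "x \<in> carrier N \<Longrightarrow> base_change_unit R S f N x \<in> carrier B"
  by (auto simp: carrier_B base_change_unit_def keys_frag_of)

lemma base_change_unit_smult:
  assumes a: "a \<in> carrier R" and x: "x \<in> carrier N"
  shows "f a \<odot>\<^bsub>B\<^esub> base_change_unit R S f N x = base_change_unit R S f N (a \<odot>\<^bsub>N\<^esub> x)"
proof -
  have "frag_of (a \<odot>\<^bsub>N\<^esub> x, \<one>\<^bsub>S\<^esub>) - frag_of (x, f a \<otimes>\<^bsub>S\<^esub> \<one>\<^bsub>S\<^esub>) \<in> ker"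
    using ker_closed(2)[OF tensor_relators_memI(3)[of a R x N "\<one>\<^bsub>S\<^esub>" T]] a x by simp
  moreover have "f a \<odot>\<^bsub>B\<^esub> base_change_unit R S f N x = cls (frag_of (x, f a \<otimes>\<^bsub>S\<^esub> \<one>\<^bsub>S\<^esub>))"
    using x ring_hom_closed[OF f a] by (simp add: base_change_unit_def smult_cls keys_frag_of)
  ultimately show ?thesis
    using x a ring_hom_closed[OF f a]
    by (simp add: base_change_unit_def cls_eq_iff[symmetric] keys_frag_of)
qed

lemma base_change_unit_zero: "base_change_unit R S f N \<zero>\<^bsub>N\<^esub> = \<zero>\<^bsub>B\<^esub>"
proof -
  interpret B: module S B by (rule module_base_change)
  have "f \<zero>\<^bsub>R\<^esub> = \<zero>\<^bsub>S\<^esub>"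
    by (rule ring_hom_zero[OF f R.ring_axioms S.ring_axioms])
  then show ?thesis
    using base_change_unit_smult[of "\<zero>\<^bsub>R\<^esub>" "\<zero>\<^bsub>N\<^esub>"] base_change_unit_closed[of "\<zero>\<^bsub>N\<^esub>"] by simp
qed

text \<open>
  In other words, if \<open>N\<close> vanishes at \<open>P\<close>, then \<open>(N \<otimes> S)\<^sub>P = 0\<close>. A formal sum representing \<open>z\<close> has
  finitely many terms, and the product of annihilators of their left factors kills all of them.
\<close>

lemma base_change_killed:
  assumes P: "primeideal P R" and kill: "\<And>x. x \<in> carrier N \<Longrightarrow> \<exists>a \<in> carrier R - P. a \<odot>\<^bsub>N\<^esub> x = \<zero>\<^bsub>N\<^esub>"
    and z: "z \<in> carrier B"
  shows "\<exists>a \<in> carrier R - P. f a \<odot>\<^bsub>B\<^esub> z = \<zero>\<^bsub>B\<^esub>"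
proof -
  note fc = ring_hom_closed[OF f]
  obtain c where c: "Poly_Mapping.keys c \<subseteq> carrier N \<times> carrier S" "z = cls c"
    using z by (auto simp: carrier_B)
  have "\<exists>a \<in> carrier R - P. F (f a) c \<in> ker"
  proof -
    have "Poly_Mapping.keys c \<subseteq> carrier N \<times> carrier S \<and> (\<exists>a \<in> carrier R - P. F (f a) c \<in> ker)"
      using c(1)
    proof (induction c rule: frag_induction)
      case zero
      show ?case using ker_closed(1) primeideal.complement_multiplicative(1)[OF P] by auto
    next
      case (one p)
      obtain x t where p: "p = (x, t)" "x \<in> carrier N" "t \<in> carrier S" using one by force
      obtain a where a: "a \<in> carrier R - P" "a \<odot>\<^bsub>N\<^esub> x = \<zero>\<^bsub>N\<^esub>" using kill[OF p(2)] by blast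
      have zero: "frag_of (\<zero>\<^bsub>N\<^esub>, t) \<in> ker"
        using ker_closed(3)[OF ker_closed(2)[OF tensor_relators_memI(1)[of "\<zero>\<^bsub>N\<^esub>" N "\<zero>\<^bsub>N\<^esub>" t T R]]] p by simp
      have "frag_of (\<zero>\<^bsub>N\<^esub>, t) - frag_of (x, f a \<otimes>\<^bsub>S\<^esub> t) \<in> ker"
        using ker_closed(2)[OF tensor_relators_memI(3)[of a R x N t T]] a p by simp
      from ker_diff[OF zero this] show ?case using a p by (auto simp: keys_frag_of)
    next
      case (diff u v)
      then obtain a b where a: "a \<in> carrier R - P" "F (f a) u \<in> ker"
        and b: "b \<in> carrier R - P" "F (f b) v \<in> ker" by blast
      have u: "Poly_Mapping.keys u \<subseteq> carrier N \<times> carrier S" and v: "Poly_Mapping.keys v \<subseteq> carrier N \<times> carrier S"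
        using diff by auto
      note ab = primeideal.complement_multiplicative(2)[OF P a(1) b(1)]
      have "F (f (a \<otimes>\<^bsub>R\<^esub> b)) u = F (f b) (F (f a) u)" "F (f (a \<otimes>\<^bsub>R\<^esub> b)) v = F (f a) (F (f b) v)"
        using a(1) b(1) u v by (simp_all add: ring_hom_mult[OF f] S.m_comm fc F_mult[symmetric])
      then have "F (f (a \<otimes>\<^bsub>R\<^esub> b)) (u - v) \<in> ker"
        unfolding frag_extend_diff using F_ker fc a b by (auto intro: ker_diff)
      then show ?case using ab keys_diff[of u v] u v by blast
    qed
    then show ?thesis by blast
  qed
  then show ?thesis
    using c fc by (auto simp: smult_cls zero_B cls_eq_iff keys_F)
qed

end



section \<open>Local cohomology as a module\<close>

lemma module_quotient_module:
  assumes A: "module R A" and K: "submodule K R A"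
  shows "module R (quotient_module A K)"
proof -
  interpret A: module R A by fact
  interpret K: submodule K R A by fact
  interpret K: abelian_subgroup K A
    by (intro abelian_subgroupI3 additive_subgroupI K.subgroup_axioms A.M.abelian_group_axioms)
  let ?Q = "quotient_module A K"
  have carr: "carrier ?Q = (\<lambda>x. K +>\<^bsub>A\<^esub> x) ` carrier A"
    by (auto simp: quotient_module_def A_RCOSETS_def')
  have add: "(K +>\<^bsub>A\<^esub> x) \<oplus>\<^bsub>?Q\<^esub> (K +>\<^bsub>A\<^esub> y) = K +>\<^bsub>A\<^esub> (x \<oplus>\<^bsub>A\<^esub> y)"
    if "x \<in> carrier A" "y \<in> carrier A" for x y
    using K.a_rcos_sum[OF that] by (simp add: quotient_module_def)
  have zero: "\<zero>\<^bsub>?Q\<^esub> = K +>\<^bsub>A\<^esub> \<zero>\<^bsub>A\<^esub>"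
    using K.a_subset by (simp add: quotient_module_def)
  have smult: "a \<odot>\<^bsub>?Q\<^esub> (K +>\<^bsub>A\<^esub> x) = K +>\<^bsub>A\<^esub> (a \<odot>\<^bsub>A\<^esub> x)"
    if a: "a \<in> carrier R" and x: "x \<in> carrier A" for a x
  proof -
    have "K +>\<^bsub>A\<^esub> (a \<odot>\<^bsub>A\<^esub> y) = K +>\<^bsub>A\<^esub> (a \<odot>\<^bsub>A\<^esub> x)" if "y \<in> K +>\<^bsub>A\<^esub> x" for y
    proof -
      from that obtain k where k: "k \<in> K" "y = k \<oplus>\<^bsub>A\<^esub> x" by (auto simp: a_r_coset_def')
      have "k \<in> carrier A" using k(1) K.a_subset by blast
      then have "a \<odot>\<^bsub>A\<^esub> y = a \<odot>\<^bsub>A\<^esub> k \<oplus>\<^bsub>A\<^esub> a \<odot>\<^bsub>A\<^esub> x"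
        using k a x by (simp add: A.smult_r_distr)
      moreover have "a \<odot>\<^bsub>A\<^esub> k \<in> K" using a k by simp
      ultimately have "a \<odot>\<^bsub>A\<^esub> y \<in> K +>\<^bsub>A\<^esub> (a \<odot>\<^bsub>A\<^esub> x)" by (auto simp: a_r_coset_def')
      from A.M.a_repr_independence[OF this _ K.a_subgroup] show ?thesis using a x by simp
    qed
    then have "(\<Union>y \<in> K +>\<^bsub>A\<^esub> x. K +>\<^bsub>A\<^esub> (a \<odot>\<^bsub>A\<^esub> y)) = K +>\<^bsub>A\<^esub> (a \<odot>\<^bsub>A\<^esub> x)"
      using K.a_rcos_self[OF x] by (intro SUP_eq_const) blast+
    then show ?thesis by (simp add: quotient_module_def)
  qed
  show ?thesis
  proof (rule moduleI)
    show "abelian_group ?Q"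
    proof (rule abelian_groupI)
      fix u assume "u \<in> carrier ?Q"
      then obtain x where x: "x \<in> carrier A" "u = K +>\<^bsub>A\<^esub> x" by (auto simp: carr)
      then have "(K +>\<^bsub>A\<^esub> \<ominus>\<^bsub>A\<^esub> x) \<oplus>\<^bsub>?Q\<^esub> u = \<zero>\<^bsub>?Q\<^esub>" by (simp add: add zero A.M.l_neg)
      then show "\<exists>v\<in>carrier ?Q. v \<oplus>\<^bsub>?Q\<^esub> u = \<zero>\<^bsub>?Q\<^esub>" using x by (auto simp: carr)
    next
      show "u \<oplus>\<^bsub>?Q\<^esub> v = v \<oplus>\<^bsub>?Q\<^esub> u" if "u \<in> carrier ?Q" "v \<in> carrier ?Q" for u v
        using that A.M.a_comm unfolding carr by (elim imageE) (simp add: add)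
    qed (auto simp: carr add zero A.M.a_assoc)
  qed (auto simp: carr add smult A.R.cring_axioms A.smult_l_distr A.smult_r_distr A.smult_assoc1)
qed

lemma (in cring) ideal_power:
  assumes "ideal I R"
  shows "ideal (I [^]\<^bsub>ideals_set R\<^esub> (n::nat)) R"
  using assms oneideal ideal_prod_is_ideal by (induction n) (simp_all add: ideals_set_def)

text \<open>
  Closure under addition holds because the powers of \<open>I\<close> decrease: the larger of two exponents
  serves both summands.
\<close>

lemma submodule_torsion_part:
  assumes M: "module R M" and I: "ideal I R"
  shows "submodule (torsion_part R I M) R M"
proof -
  interpret M: module R M by fact
  let ?pow = "\<lambda>n::nat. I [^]\<^bsub>ideals_set R\<^esub> n"
  note id = M.R.ideal_power[OF I]
  have Suc: "?pow (Suc n) \<subseteq> ?pow n" for n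
    using M.R.ideal_prod_inter[OF id[of n] I] by (simp add: ideals_set_def)
  have anti: "?pow n \<subseteq> ?pow m" if "m \<le> n" for m n
    using lift_Suc_antimono_le[of ?pow, OF Suc that] .
  have pc: "a \<in> carrier R" if "a \<in> ?pow n" for a n
    using ideal.Icarr[OF id that] .
  show ?thesis
  proof (rule M.submoduleI)
    show "torsion_part R I M \<subseteq> carrier M" by (auto simp: torsion_part_def)
    show "\<zero>\<^bsub>M\<^esub> \<in> torsion_part R I M" using pc by (auto simp: torsion_part_def)
    show "\<ominus>\<^bsub>M\<^esub> x \<in> torsion_part R I M" if "x \<in> torsion_part R I M" for x
    proof -
      from that obtain n where x: "x \<in> carrier M" "\<forall>a \<in> ?pow n. a \<odot>\<^bsub>M\<^esub> x = \<zero>\<^bsub>M\<^esub>"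
        by (auto simp: torsion_part_def)
      then have "\<forall>a \<in> ?pow n. a \<odot>\<^bsub>M\<^esub> (\<ominus>\<^bsub>M\<^esub> x) = \<zero>\<^bsub>M\<^esub>" using pc by (simp add: M.smult_r_minus)
      then show ?thesis using x(1) by (auto simp: torsion_part_def)
    qed
    show "x \<oplus>\<^bsub>M\<^esub> y \<in> torsion_part R I M"
      if xy: "x \<in> torsion_part R I M" "y \<in> torsion_part R I M" for x y
    proof -
      from xy obtain m n where x: "x \<in> carrier M" "\<forall>a \<in> ?pow m. a \<odot>\<^bsub>M\<^esub> x = \<zero>\<^bsub>M\<^esub>"
        and y: "y \<in> carrier M" "\<forall>a \<in> ?pow n. a \<odot>\<^bsub>M\<^esub> y = \<zero>\<^bsub>M\<^esub>"
        by (auto simp: torsion_part_def)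
      have "a \<odot>\<^bsub>M\<^esub> (x \<oplus>\<^bsub>M\<^esub> y) = \<zero>\<^bsub>M\<^esub>" if a: "a \<in> ?pow (max m n)" for a
      proof -
        have "a \<in> ?pow m" "a \<in> ?pow n" using a anti[of m "max m n"] anti[of n "max m n"] by auto
        then show ?thesis using x y pc[OF a] by (simp add: M.smult_r_distr)
      qed
      then show ?thesis using x(1) y(1) by (auto simp: torsion_part_def)
    qed
    show "r \<odot>\<^bsub>M\<^esub> x \<in> torsion_part R I M" if r: "r \<in> carrier R" and "x \<in> torsion_part R I M" for r x
    proof -
      from that obtain n where x: "x \<in> carrier M" "\<forall>a \<in> ?pow n. a \<odot>\<^bsub>M\<^esub> x = \<zero>\<^bsub>M\<^esub>"
        by (auto simp: torsion_part_def)
      have "a \<odot>\<^bsub>M\<^esub> (r \<odot>\<^bsub>M\<^esub> x) = \<zero>\<^bsub>M\<^esub>" if a: "a \<in> ?pow n" for a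
      proof -
        have "a \<odot>\<^bsub>M\<^esub> (r \<odot>\<^bsub>M\<^esub> x) = r \<odot>\<^bsub>M\<^esub> (a \<odot>\<^bsub>M\<^esub> x)"
          using r x(1) pc[OF a] by (simp add: M.smult_assoc1[symmetric] M.R.m_comm)
        then show ?thesis using x(2) a r by simp
      qed
      then show ?thesis using x(1) r by (auto simp: torsion_part_def)
    qed
  qed
qed

lemma mod_homD:
  assumes "h \<in> mod_hom R A B"
  shows "x \<in> carrier A \<Longrightarrow> h x \<in> carrier B"
    "x \<in> carrier A \<Longrightarrow> y \<in> carrier A \<Longrightarrow> h (x \<oplus>\<^bsub>A\<^esub> y) = h x \<oplus>\<^bsub>B\<^esub> h y"
    "a \<in> carrier R \<Longrightarrow> x \<in> carrier A \<Longrightarrow> h (a \<odot>\<^bsub>A\<^esub> x) = a \<odot>\<^bsub>B\<^esub> h x"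
  using assms by (simp_all add: mod_hom_def Pi_iff)

lemma mod_hom_zero:
  assumes "module R A" "module R B" "h \<in> mod_hom R A B"
  shows "h \<zero>\<^bsub>A\<^esub> = \<zero>\<^bsub>B\<^esub>"
proof -
  interpret A: module R A by fact
  interpret B: module R B by fact
  show ?thesis
    using mod_homD(3)[OF assms(3), of "\<zero>\<^bsub>R\<^esub>" "\<zero>\<^bsub>A\<^esub>"] mod_homD(1)[OF assms(3), of "\<zero>\<^bsub>A\<^esub>"] by simp
qed

lemma mod_hom_torsion_part:
  assumes "module R A" "module R B" "h \<in> mod_hom R A B" "ideal I R" "x \<in> torsion_part R I A"
  shows "h x \<in> torsion_part R I B"
proof -
  interpret A: module R A by fact
  note id = A.R.ideal_power[OF assms(4)]
  obtain n :: nat where x: "x \<in> carrier A" "\<forall>a \<in> I [^]\<^bsub>ideals_set R\<^esub> n. a \<odot>\<^bsub>A\<^esub> x = \<zero>\<^bsub>A\<^esub>"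
    using assms(5) by (auto simp: torsion_part_def)
  have "a \<odot>\<^bsub>B\<^esub> h x = \<zero>\<^bsub>B\<^esub>" if a: "a \<in> I [^]\<^bsub>ideals_set R\<^esub> n" for a
  proof -
    have "a \<odot>\<^bsub>B\<^esub> h x = h (a \<odot>\<^bsub>A\<^esub> x)"
      using assms(3) x(1) ideal.Icarr[OF id a] by (simp add: mod_hom_def)
    then show ?thesis using x(2) a mod_hom_zero[OF assms(1-3)] by simp
  qed
  then show ?thesis using assms(3) x(1) by (auto simp: torsion_part_def mod_hom_def)
qed

lemma submodule_kernel:
  assumes A: "module R A" and B: "module R B" and h: "h \<in> mod_hom R A B" and H: "submodule H R A"
  shows "submodule {x \<in> H. h x = \<zero>\<^bsub>B\<^esub>} R A"
proof -
  interpret A: module R A by fact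
  interpret B: module R B by fact
  note H = A.submoduleE[OF H] subgroup.one_closed[OF submodule.axioms(1)[OF H]]
  have hadd: "h (x \<oplus>\<^bsub>A\<^esub> y) = h x \<oplus>\<^bsub>B\<^esub> h y" if "x \<in> H" "y \<in> H" for x y
    using mod_homD[OF h] that H(1) by (metis subsetD)
  have hsmult: "h (a \<odot>\<^bsub>A\<^esub> x) = a \<odot>\<^bsub>B\<^esub> h x" if "a \<in> carrier R" "x \<in> H" for a x
    using mod_homD[OF h] that H(1) by (metis subsetD)
  show ?thesis
  proof (rule A.submoduleI)
    show "\<ominus>\<^bsub>A\<^esub> x \<in> {x \<in> H. h x = \<zero>\<^bsub>B\<^esub>}" if "x \<in> {x \<in> H. h x = \<zero>\<^bsub>B\<^esub>}" for x
    proof -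
      have x: "x \<in> H" "h x = \<zero>\<^bsub>B\<^esub>" "x \<in> carrier A" using that H(1) by auto
      have "h (\<ominus>\<^bsub>A\<^esub> x) = (\<ominus>\<^bsub>R\<^esub> \<one>\<^bsub>R\<^esub>) \<odot>\<^bsub>B\<^esub> h x"
        using hsmult[of "\<ominus>\<^bsub>R\<^esub> \<one>\<^bsub>R\<^esub>" x] x by (simp add: A.smult_l_minus)
      then show ?thesis using x H(3) by simp
    qed
  qed (use H hadd hsmult mod_hom_zero[OF A B h] in auto)
qed

lemma submodule_image:
  assumes A: "module R A" and B: "module R B" and h: "h \<in> mod_hom R A B" and H: "submodule H R A"
  shows "submodule (h ` H) R B"
proof -
  interpret A: module R A by fact
  interpret B: module R B by fact
  note H = A.submoduleE[OF H] subgroup.one_closed[OF submodule.axioms(1)[OF H]]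
  have hc: "h x \<in> carrier B" if "x \<in> H" for x
    using mod_homD[OF h] that H(1) by (metis subsetD)
  have hadd: "h x \<oplus>\<^bsub>B\<^esub> h y = h (x \<oplus>\<^bsub>A\<^esub> y)" if "x \<in> H" "y \<in> H" for x y
    using mod_homD[OF h] that H(1) by (metis subsetD)
  have hsmult: "a \<odot>\<^bsub>B\<^esub> h x = h (a \<odot>\<^bsub>A\<^esub> x)" if "a \<in> carrier R" "x \<in> H" for a x
    using mod_homD[OF h] that H(1) by (metis subsetD)
  have smult: "a \<odot>\<^bsub>B\<^esub> y \<in> h ` H" if "a \<in> carrier R" "y \<in> h ` H" for a y
    using that hsmult H(4) by auto
  show ?thesis
  proof (rule B.submoduleI)
    show "h ` H \<subseteq> carrier B" using hc by blast
    show "\<zero>\<^bsub>B\<^esub> \<in> h ` H" using mod_hom_zero[OF A B h] H(7) by force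
    show "\<ominus>\<^bsub>B\<^esub> y \<in> h ` H" if "y \<in> h ` H" for y
      using smult[OF _ that, of "\<ominus>\<^bsub>R\<^esub> \<one>\<^bsub>R\<^esub>"] that hc by (auto simp: B.smult_l_minus)
    show "y \<oplus>\<^bsub>B\<^esub> z \<in> h ` H" if "y \<in> h ` H" "z \<in> h ` H" for y z
      using that hadd H(5) by auto
  qed (rule smult)
qed

text \<open>
  The quotient defining local cohomology is taken inside the module of torsion cocycles, so the
  coboundaries have to be a submodule of that module and not just of the ambient injective module.
\<close>

lemma submodule_within:
  assumes "module R A" "submodule H R A" "submodule K R A" "K \<subseteq> H"
  shows "submodule K R (A\<lparr>carrier := H\<rparr>)"
proof -
  interpret H: module R "A\<lparr>carrier := H\<rparr>"
    by (rule submodule.submodule_is_module[OF assms(2,1)])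
  show ?thesis
    using H.module_incl_imp_submodule[of K] submodule.submodule_is_module[OF assms(3,1)] assms(4) by simp
qed

lemma module_local_cohomology:
  assumes "cring R" and I: "ideal I R" and res: "injective_resolution R M E d \<epsilon>"
  shows "module R (local_cohomology R I E d i)"
proof -
  have E: "module R (E n)" and d: "d n \<in> mod_hom R (E n) (E (Suc n))"
    and exact: "d n ` carrier (E n) = {x \<in> carrier (E (Suc n)). d (Suc n) x = \<zero>\<^bsub>E (Suc (Suc n))\<^esub>}" for n
    using res by (simp_all add: injective_resolution_def injective_module_def)
  let ?Z = "{x \<in> torsion_part R I (E i). d i x = \<zero>\<^bsub>E (Suc i)\<^esub>}"
  let ?K = "case i of 0 \<Rightarrow> {\<zero>\<^bsub>E 0\<^esub>} | Suc j \<Rightarrow> d j ` torsion_part R I (E j)"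
  note tors = submodule_torsion_part[OF E I]
  have Z: "submodule ?Z R (E i)"
    by (rule submodule_kernel[OF E E d tors])
  have "submodule ?K R (E i) \<and> ?K \<subseteq> ?Z"
  proof (cases i)
    case 0
    interpret E: module R "E 0" by (rule E)
    have "submodule {\<zero>\<^bsub>E 0\<^esub>} R (E 0)" by (rule E.submoduleI) auto
    moreover have "\<zero>\<^bsub>E 0\<^esub> \<in> ?Z"
      using subgroup.one_closed[OF submodule.axioms(1)[OF Z]] 0 by simp
    ultimately show ?thesis using 0 by simp
  next
    case (Suc j)
    have "d j ` torsion_part R I (E j) \<subseteq> ?Z"
    proof (rule image_subsetI)
      fix x assume x: "x \<in> torsion_part R I (E j)"
      then have "d j x \<in> d j ` carrier (E j)" by (auto simp: torsion_part_def)
      then show "d j x \<in> ?Z"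
        using mod_hom_torsion_part[OF E E d I x] Suc unfolding exact by simp
    qed
    then show ?thesis using submodule_image[OF E E d tors, of j] Suc by simp
  qed
  then have "submodule ?K R ((E i)\<lparr>carrier := ?Z\<rparr>)"
    using submodule_within[OF E Z] by blast
  then show ?thesis
    unfolding local_cohomology_def
    by (rule module_quotient_module[OF submodule.submodule_is_module[OF Z E]])
qed

section \<open>Descent of closed supports along pure extensions\<close>

lemma ideal_contraction:
  assumes "cring R" "cring S" and f: "f \<in> ring_hom R S" and J: "ideal J S"
  shows "ideal {a \<in> carrier R. f a \<in> J} R"
proof -
  interpret R: cring R by fact
  interpret S: cring S by fact
  interpret J: ideal J S by fact
  interpret f: ring_hom_cring R S f
    by (intro ring_hom_cringI ring_hom_ringI2 f R.ring_axioms S.ring_axioms R.cring_axioms S.cring_axioms)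
  show ?thesis
  proof (rule idealI[OF R.ring_axioms])
    show "subgroup {a \<in> carrier R. f a \<in> J} (add_monoid R)"
    proof (rule R.add.subgroupI)
      show "{a \<in> carrier R. f a \<in> J} \<noteq> {}" using f.hom_zero by force
    qed auto
  qed (auto intro: J.I_l_closed J.I_r_closed)
qed

text \<open>
  The inclusion from left to right rests on purity, which gives \<open>a\<^sup>n x = 0\<close> from \<open>a\<^sup>n x \<otimes> 1 = 0\<close>. The
  other inclusion rests on the existence of a prime \<open>Q\<close> above \<open>J\<close> whose contraction lies in \<open>P\<close>.
\<close>

lemma Supp_descends:
  assumes "cring R" "cring S" "noetherian_ring S"
    and pure: "pure_extension R S f" and N: "module R N" and J: "ideal J S"
    and Supp: "Supp S (base_change R S f N) = {Q \<in> Spec S. J \<subseteq> Q}"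
  shows "Supp R N = {P \<in> Spec R. {a \<in> carrier R. f a \<in> J} \<subseteq> P}"
proof (rule Set.set_eqI)
  fix P
  interpret R: cring R by fact
  interpret S: cring S by fact
  interpret S: noetherian_ring S by fact
  interpret N: module R N by fact
  let ?B = "base_change R S f N" and ?u = "base_change_unit R S f N"
  have f: "f \<in> ring_hom R S" using pure by (simp add: pure_extension_def)
  note fc = ring_hom_closed[OF f]
  interpret B: module S ?B by (rule module_base_change) (fact assms f)+
  note unit = base_change_unit_closed[OF assms(1,2) f N] base_change_unit_smult[OF assms(1,2) f N]
    base_change_unit_zero[OF assms(1,2) f N]
  show "P \<in> Supp R N \<longleftrightarrow> P \<in> {P \<in> Spec R. {a \<in> carrier R. f a \<in> J} \<subseteq> P}"
  proof
    assume "P \<in> Supp R N"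
    then obtain x where P: "primeideal P R" and x: "x \<in> carrier N"
      and ann: "\<And>a. a \<in> carrier R \<Longrightarrow> a \<odot>\<^bsub>N\<^esub> x = \<zero>\<^bsub>N\<^esub> \<Longrightarrow> a \<in> P"
      unfolding Supp_iff_annihilator[OF N] by blast
    have "a \<in> P" if a: "a \<in> carrier R" "f a \<in> J" for a
    proof -
      have "f a \<in> Q" if "Q \<in> Supp S ?B" for Q using that a Supp by auto
      then obtain n :: nat where n: "f a [^]\<^bsub>S\<^esub> n \<odot>\<^bsub>?B\<^esub> ?u x = \<zero>\<^bsub>?B\<^esub>"
        using power_annihilates[OF B.module_axioms assms(3) unit(1)[OF x] fc[OF a(1)]] by blast
      have hom: "f a [^]\<^bsub>S\<^esub> n = f (a [^]\<^bsub>R\<^esub> n)"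
        using a(1) by (induction n) (simp_all add: ring_hom_mult[OF f] ring_hom_one[OF f])
      have an: "a [^]\<^bsub>R\<^esub> n \<in> carrier R" using a(1) by simp
      have "?u (a [^]\<^bsub>R\<^esub> n \<odot>\<^bsub>N\<^esub> x) = ?u \<zero>\<^bsub>N\<^esub>"
        using n unfolding hom unit(2)[OF an x] unit(3) .
      then have "a [^]\<^bsub>R\<^esub> n \<odot>\<^bsub>N\<^esub> x = \<zero>\<^bsub>N\<^esub>"
        using pure_extension_every_module[OF assms(1,2) pure N] an x by (simp add: inj_on_eq_iff)
      with ann an have "a [^]\<^bsub>R\<^esub> n \<in> P" by blast
      then show "a \<in> P"
      proof (induction n)
        case 0
        then have "carrier R = P"
          using ideal.one_imp_carrier[OF primeideal.axioms(1)[OF P]] by simp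
        then show ?case using a(1) by simp
      next
        case (Suc n)
        then show ?case
          using primeideal.I_prime[OF P, of "a [^]\<^bsub>R\<^esub> n" a] a(1) by auto
      qed
    qed
    then show "P \<in> {P \<in> Spec R. {a \<in> carrier R. f a \<in> J} \<subseteq> P}"
      using P by (auto simp: Spec_def)
  next
    assume "P \<in> {P \<in> Spec R. {a \<in> carrier R. f a \<in> J} \<subseteq> P}"
    then have P: "primeideal P R" and sub: "\<And>a. a \<in> carrier R \<Longrightarrow> f a \<in> J \<Longrightarrow> a \<in> P"
      by (auto simp: Spec_def)
    let ?T = "f ` (carrier R - P)"
    have one: "\<one>\<^bsub>S\<^esub> \<in> ?T"
      using primeideal.complement_multiplicative(1)[OF P] ring_hom_one[OF f] by (metis imageI)
    have mult: "s \<otimes>\<^bsub>S\<^esub> t \<in> ?T" if st: "s \<in> ?T" "t \<in> ?T" for s t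
    proof -
      obtain a b where ab: "a \<in> carrier R - P" "s = f a" "b \<in> carrier R - P" "t = f b"
        using st by blast
      note primeideal.complement_multiplicative(2)[OF P ab(1,3)]
      moreover have "s \<otimes>\<^bsub>S\<^esub> t = f (a \<otimes>\<^bsub>R\<^esub> b)" using ab by (simp add: ring_hom_mult[OF f])
      ultimately show ?thesis by blast
    qed
    obtain Q where Q: "primeideal Q S" "J \<subseteq> Q" "Q \<inter> ?T = {}"
    proof (rule S.prime_ideal_avoiding[OF assms(2) J _ one mult])
      show "?T \<subseteq> carrier S" using fc by auto
      show "J \<inter> ?T = {}" using sub by auto
    qed
    then have "Q \<in> Supp S ?B" using Supp by (simp add: Spec_def)
    then obtain z where z: "z \<in> carrier ?B"
      and ann: "\<And>s. s \<in> carrier S \<Longrightarrow> s \<odot>\<^bsub>?B\<^esub> z = \<zero>\<^bsub>?B\<^esub> \<Longrightarrow> s \<in> Q"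
      unfolding Supp_iff_annihilator[OF B.module_axioms] by blast
    show "P \<in> Supp R N"
    proof (rule ccontr)
      assume "P \<notin> Supp R N"
      then have "\<exists>a \<in> carrier R - P. a \<odot>\<^bsub>N\<^esub> x = \<zero>\<^bsub>N\<^esub>" if "x \<in> carrier N" for x
        using P that unfolding Supp_iff_annihilator[OF N] by blast
      from base_change_killed[OF assms(1,2) f N P this z]
      obtain a where "a \<in> carrier R - P" "f a \<odot>\<^bsub>?B\<^esub> z = \<zero>\<^bsub>?B\<^esub>" by blast
      then show False using ann[of "f a"] fc[of a] Q(3) by auto
    qed
  qed
qed

theorem theorem3p4:
  fixes R :: "('a, 'r) ring_scheme" and S :: "('b, 's) ring_scheme" and f :: "'a \<Rightarrow> 'b"
    and I :: "'a set" and M :: "('a, 'm) module"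
    and E :: "nat \<Rightarrow> ('a, 'e) module" and d :: "nat \<Rightarrow> 'e \<Rightarrow> 'e" and \<epsilon> :: "'m \<Rightarrow> 'e"
    and i :: nat
  assumes "cring R" and "noetherian_ring R"
    and "cring S" and "noetherian_ring S"
    and "pure_extension R S f"
    and "ideal I R"
    and "module R M"
    and "injective_resolution R M E d \<epsilon>"
    and "closedin (zariski_topology S) (Supp S (base_change R S f (local_cohomology R I E d i)))"
  shows "closedin (zariski_topology R) (Supp R (local_cohomology R I E d i))"
proof -
  let ?H = "local_cohomology R I E d i"
  have f: "f \<in> ring_hom R S" using assms(5) by (simp add: pure_extension_def)
  obtain J where J: "ideal J S" "Supp S (base_change R S f ?H) = {Q \<in> Spec S. J \<subseteq> Q}"
    using assms(9) unfolding cring.closedin_zariski[OF assms(3)] by blast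
  have "module R ?H" by (rule module_local_cohomology) (fact assms)+
  then have "Supp R ?H = {P \<in> Spec R. {a \<in> carrier R. f a \<in> J} \<subseteq> P}"
    using assms(1,3-5) J by (intro Supp_descends)
  then show ?thesis
    unfolding cring.closedin_zariski[OF assms(1)]
    using ideal_contraction[OF assms(1,3) f J(1)] by blast
qed

end
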